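(* Fix a positive integer $d$. Given $\mathbf{V} \in \mathbb{R}^{n \times d}$, let $\mathbf{A} = \mathbf{V}\mathbf{V}^T$. An optimal solution of the correlation clustering problem for $\mathbf{A}$ — maximize $\sum_{1\le i<j\le n} A_{ij}\,\mathbf{x}_i^T\mathbf{x}_j$ over all $\mathbf{x}_i \in \{\mathbf{e}_1,\dots,\mathbf{e}_n\}$ ($i=1,\dots,n$), where $\mathbf{e}_k$ is the $k$-th standard basis vector of $\mathbb{R}^n$, equivalently maximize over partitions of $\{1,\dots,n\}$ the sum of $A_{ij}$ over pairs $i<j$ in the same cluster — can be computed in $O(n^{d^2})$ time.
   Context: Time is measured in arithmetic operations on real numbers, with the rank bound $d$ treated as a fixed constant. *)

theory Defs
  imports Complex_Main
begin

definition gram :: "nat \<Rightarrow> (nat \<Rightarrow> nat \<Rightarrow> real) \<Rightarrow> nat \<Rightarrow> nat \<Rightarrow> real" where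
  "gram d V i j = (\<Sum>k<d. V i k * V j k)"

text \<open>Objective for a cluster assignment c (x_i = e_{c i}, so x_i^T x_j = 1 iff c i = c j):
  sum over i < j < n of A_ij x_i^T x_j.\<close>
definition cc_obj :: "nat \<Rightarrow> (nat \<Rightarrow> nat \<Rightarrow> real) \<Rightarrow> (nat \<Rightarrow> 'a) \<Rightarrow> real" where
  "cc_obj n A c = (\<Sum>i<n. \<Sum>j\<in>{i<..<n}. if c i = c j then A i j else 0)"

definition cc_optimal :: "nat \<Rightarrow> (nat \<Rightarrow> nat \<Rightarrow> real) \<Rightarrow> (nat \<Rightarrow> 'a) \<Rightarrow> bool" where
  "cc_optimal n A c \<longleftrightarrow> (\<forall>\<sigma>::nat \<Rightarrow> nat. (\<forall>i<n. \<sigma> i < n) \<longrightarrow> cc_obj n A \<sigma> \<le> cc_obj n A c)"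

text \<open>Two register files: integer registers (used for indices/labels; only addition,
  subtraction and comparison, no multiplication) and real registers (exact real
  arithmetic +, -, *, / and comparison). Indirect addressing uses integer registers.
  There is no real-to-integer conversion (no floor).\<close>

datatype instr =
    IConst nat int
  | IAdd nat nat nat
  | ISub nat nat nat
  | ILoad nat nat
  | IStore nat nat
  | RConst nat int
  | RAdd nat nat nat
  | RSub nat nat nat
  | RMul nat nat nat
  | RDiv nat nat nat
  | RLoad nat nat
  | RStore nat nat
  | IToR nat nat
  | JmpILe nat nat nat
  | JmpRLe nat nat nat
  | Jmp nat
  | Halt

record state =
  pc :: nat
  ireg :: "nat \<Rightarrow> int"
  rreg :: "nat \<Rightarrow> real"

definition halted :: "instr list \<Rightarrow> state \<Rightarrow> bool" where
  "halted P s \<longleftrightarrow> pc s \<ge> length P \<or> P ! pc s = Halt"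

fun exec :: "instr \<Rightarrow> state \<Rightarrow> state" where
  "exec (IConst r k) s = s\<lparr>pc := Suc (pc s), ireg := (ireg s)(r := k)\<rparr>"
| "exec (IAdd r a b) s = s\<lparr>pc := Suc (pc s), ireg := (ireg s)(r := ireg s a + ireg s b)\<rparr>"
| "exec (ISub r a b) s = s\<lparr>pc := Suc (pc s), ireg := (ireg s)(r := ireg s a - ireg s b)\<rparr>"
| "exec (ILoad r a) s = s\<lparr>pc := Suc (pc s), ireg := (ireg s)(r := ireg s (nat (ireg s a)))\<rparr>"
| "exec (IStore a r) s = s\<lparr>pc := Suc (pc s), ireg := (ireg s)(nat (ireg s a) := ireg s r)\<rparr>"
| "exec (RConst r k) s = s\<lparr>pc := Suc (pc s), rreg := (rreg s)(r := of_int k)\<rparr>"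
| "exec (RAdd r a b) s = s\<lparr>pc := Suc (pc s), rreg := (rreg s)(r := rreg s a + rreg s b)\<rparr>"
| "exec (RSub r a b) s = s\<lparr>pc := Suc (pc s), rreg := (rreg s)(r := rreg s a - rreg s b)\<rparr>"
| "exec (RMul r a b) s = s\<lparr>pc := Suc (pc s), rreg := (rreg s)(r := rreg s a * rreg s b)\<rparr>"
| "exec (RDiv r a b) s = s\<lparr>pc := Suc (pc s), rreg := (rreg s)(r := rreg s a / rreg s b)\<rparr>"
| "exec (RLoad r a) s = s\<lparr>pc := Suc (pc s), rreg := (rreg s)(r := rreg s (nat (ireg s a)))\<rparr>"
| "exec (RStore a r) s = s\<lparr>pc := Suc (pc s), rreg := (rreg s)(nat (ireg s a) := rreg s r)\<rparr>"
| "exec (IToR r a) s = s\<lparr>pc := Suc (pc s), rreg := (rreg s)(r := of_int (ireg s a))\<rparr>"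
| "exec (JmpILe a b l) s = s\<lparr>pc := (if ireg s a \<le> ireg s b then l else Suc (pc s))\<rparr>"
| "exec (JmpRLe a b l) s = s\<lparr>pc := (if rreg s a \<le> rreg s b then l else Suc (pc s))\<rparr>"
| "exec (Jmp l) s = s\<lparr>pc := l\<rparr>"
| "exec Halt s = s"

definition step :: "instr list \<Rightarrow> state \<Rightarrow> state" where
  "step P s = (if halted P s then s else exec (P ! pc s) s)"

text \<open>Running for k steps; the program halts within k steps iff halted P (run P s k).\<close>
definition run :: "instr list \<Rightarrow> state \<Rightarrow> nat \<Rightarrow> state" where
  "run P s k = (step P ^^ k) s"

text \<open>Input encoding: I[0] = n, I[1] = d, R[i*d+k] = V i k for i < n, k < d,
  everything else 0. Output: the cluster label of point i is I[i] (i < n) upon halting.\<close>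
definition init :: "nat \<Rightarrow> nat \<Rightarrow> (nat \<Rightarrow> nat \<Rightarrow> real) \<Rightarrow> state" where
  "init n d V = \<lparr>pc = 0,
     ireg = (\<lambda>r. if r = 0 then int n else if r = 1 then int d else 0),
     rreg = (\<lambda>r. if r < n * d then V (r div d) (r mod d) else 0)\<rparr>"

end

theory Submission
  imports Defs
begin

text \<open>Up to a constant and a factor 2, the objective is the sum of the squared norms of the cluster
  sums. Merging two clusters whose sums have nonnegative inner product does not decrease it, and of
  any \<open>d + 2\<close> vectors in \<open>\<real>\<^sup>d\<close> two have nonnegative inner product; so \<open>d + 1\<close> labels suffice. In an
  optimal labelling with cluster sums \<open>w\<^sub>a\<close>, every nonzero point \<open>v\<^sub>i\<close> with label \<open>a\<close> satisfies
  \<open>(w\<^sub>a - w\<^sub>b) \<bullet> v\<^sub>i > 0\<close> for all \<open>b \<noteq> a\<close>, since moving it to \<open>b\<close> does not help. Subtracting \<open>w\<^sub>d\<close>, the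
  labelling is the sign pattern of a point of \<open>\<real>\<^sup>d\<^sup>*\<^sup>d\<close> with respect to a central arrangement of
  \<open>O(n)\<close> hyperplanes. Each cell of such an arrangement is found by walking to a wall, then to a wall
  of that wall, and so on: \<open>d * d - 1\<close> walls, a coordinate and a sign determine the sign pattern, ties
  being broken lexicographically along the flag, so that no general position is needed. There are
  \<open>O(n^(d * d - 1))\<close> such choices, and the labelling belonging to each of them is computed
  and evaluated in time \<open>O(n)\<close>.\<close>


text \<open>Candidates are never checked. Each of them yields some labelling with labels at most
  \<open>d\<close>, whose score is a true value of the objective; so wrong guesses, even those that
  divide by a zero pivot, are harmless, and one good guess suffices. Zero points satisfy no strict
  inequality, but they do not affect any cluster sum and may get any label. Fixing one cluster sum
  to be zero is what lowers the dimension from \<open>(d + 1) * d\<close> to \<open>d * d\<close>,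
  and with it the exponent. For fixed \<open>d\<close> all choices other than the points defining
  the walls are bounded in number and are unrolled in the program text; only the points are
  enumerated at run time. The machine has no integer multiplication and no conversion from reals to
  integers. Addresses are therefore formed by repeated addition, and a label is first computed as a
  real number, by an expression whose size depends on \<open>d\<close> only, and then recognised by
  comparison with the constants \<open>0\<close> to \<open>d\<close>. The input occupies the
  registers in which the program keeps its own variables, so it has to be moved away before the
  search.\<close>

lemma sum_divmod:
  "(\<Sum>q<m * d. g (q div d) (q mod d)) = (\<Sum>a<m. \<Sum>k<(d::nat). g a k :: real)"
proof (cases "d = 0")
  case False
  have "(\<Sum>q<m * d. g (q div d) (q mod d))
      = (\<Sum>a<m. \<Sum>q\<in>{a * d..<a * d + d}. g (q div d) (q mod d))"
    by (rule sum.nat_group[symmetric])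
  also have "\<dots> = (\<Sum>a<m. \<Sum>k<d. g a k)"
  proof (rule sum.cong[OF refl])
    fix a
    have "(\<Sum>q\<in>{a * d..<a * d + d}. g (q div d) (q mod d))
        = (\<Sum>k\<in>{0..<d}. g ((k + a * d) div d) ((k + a * d) mod d))"
      using sum.shift_bounds_nat_ivl[of "\<lambda>q. g (q div d) (q mod d)" 0 "a * d" d]
      by (simp add: add.commute)
    also have "\<dots> = (\<Sum>k<d. g a k)"
      by (rule sum.cong) (auto simp: lessThan_atLeast0)
    finally show "(\<Sum>q\<in>{a * d..<a * d + d}. g (q div d) (q mod d)) = (\<Sum>k<d. g a k)" .
  qed
  finally show ?thesis .
qed simp

section \<open>The objective as a sum of squared cluster sums\<close>

definition same_sum :: "nat \<Rightarrow> (nat \<Rightarrow> nat \<Rightarrow> real) \<Rightarrow> (nat \<Rightarrow> 'a) \<Rightarrow> real" where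
  "same_sum n A c = (\<Sum>i<n. \<Sum>j<n. if c i = c j then A i j else 0)"

definition csum :: "nat \<Rightarrow> (nat \<Rightarrow> nat \<Rightarrow> real) \<Rightarrow> (nat \<Rightarrow> 'a) \<Rightarrow> 'a \<Rightarrow> nat \<Rightarrow> real" where
  "csum n V c a k = (\<Sum>i<n. if c i = a then V i k else 0)"

lemma same_sum_eq_cc_obj:
  assumes "\<And>i j. A i j = A j i"
  shows "same_sum n A c = 2 * cc_obj n A c + (\<Sum>i<n. A i i)"
proof (induction n)
  case 0
  show ?case by (simp add: same_sum_def cc_obj_def)
next
  case (Suc n)
  let ?t = "\<lambda>i j. if c i = c j then A i j else 0"
  have [simp]: "{n<..<Suc n} = {}" by auto
  have "(\<Sum>j\<in>{i<..<Suc n}. ?t i j) = (\<Sum>j\<in>{i<..<n}. ?t i j) + ?t i n" if "i < n" for i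
  proof -
    have "{i<..<Suc n} = insert n {i<..<n}" using that by auto
    then show ?thesis by simp
  qed
  then have "(\<Sum>i<n. \<Sum>j\<in>{i<..<Suc n}. ?t i j) = (\<Sum>i<n. (\<Sum>j\<in>{i<..<n}. ?t i j) + ?t i n)"
    by (intro sum.cong) auto
  then have "cc_obj (Suc n) A c = cc_obj n A c + (\<Sum>i<n. ?t i n)"
    by (simp add: cc_obj_def sum.distrib)
  moreover have "same_sum (Suc n) A c = same_sum n A c + 2 * (\<Sum>i<n. ?t i n) + A n n"
  proof -
    have "(\<Sum>j<n. ?t n j) = (\<Sum>i<n. ?t i n)"
      using assms by (intro sum.cong) auto
    then show ?thesis by (simp add: same_sum_def sum.distrib)
  qed
  ultimately show ?case using Suc.IH by simp
qed

lemma gram_commute: "gram d V i j = gram d V j i"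
  by (simp add: gram_def mult.commute)

text \<open>The label types of \<open>c\<close> and \<open>c'\<close> are independent: the program
  outputs integer labels, while its competitors have natural ones.\<close>

lemma cc_obj_le_iff:
  "cc_obj n (gram d V) c \<le> cc_obj n (gram d V) c' \<longleftrightarrow>
     same_sum n (gram d V) c \<le> same_sum n (gram d V) c'"
  using same_sum_eq_cc_obj[of "gram d V" n c] same_sum_eq_cc_obj[of "gram d V" n c']
  by (simp add: gram_commute)

lemma same_sum_inj:
  assumes "inj_on g (c ` {..<n})"
  shows "same_sum n A (g \<circ> c) = same_sum n A c"
  unfolding same_sum_def
  by (intro sum.cong refl) (use assms in \<open>auto simp: inj_on_def\<close>)

text \<open>Expanding the square of a cluster sum gives one product \<open>V i k * V j k\<close> for
  each ordered pair in that cluster, and summing over \<open>k\<close> gives the Gram entry. Labels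
  in \<open>L\<close> that no point carries contribute zero.\<close>

lemma same_sum_gram:
  assumes "finite L" "c ` {..<n} \<subseteq> L"
  shows "same_sum n (gram d V) c = (\<Sum>a\<in>L. \<Sum>k<d. (csum n V c a k)\<^sup>2)"
proof -
  have "(\<Sum>a\<in>L. (if c i = a then V i k else 0) * (if c j = a then V j k else 0))
      = (if c i = c j then V i k * V j k else 0)" if "i < n" for i j k
  proof -
    have "(\<Sum>a\<in>L. (if c i = a then V i k else 0) * (if c j = a then V j k else 0))
       = (\<Sum>a\<in>L. if c i = a then (if c j = c i then V i k * V j k else 0) else 0)"
      by (intro sum.cong) auto
    also have "\<dots> = (if c j = c i then V i k * V j k else 0)"
      using assms that by (simp add: sum.delta image_subset_iff)
    finally show ?thesis by (simp add: eq_commute)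
  qed
  note delta = this
  have "(\<Sum>a\<in>L. \<Sum>k<d. (csum n V c a k)\<^sup>2)
     = (\<Sum>a\<in>L. \<Sum>k<d. \<Sum>i<n. \<Sum>j<n. (if c i = a then V i k else 0) * (if c j = a then V j k else 0))"
    by (simp only: csum_def power2_eq_square sum_product)
  also have "\<dots> = (\<Sum>k<d. \<Sum>a\<in>L. \<Sum>i<n. \<Sum>j<n. (if c i = a then V i k else 0) * (if c j = a then V j k else 0))"
    by (rule sum.swap)
  also have "\<dots> = (\<Sum>k<d. \<Sum>i<n. \<Sum>a\<in>L. \<Sum>j<n. (if c i = a then V i k else 0) * (if c j = a then V j k else 0))"
    by (rule sum.cong[OF refl], rule sum.swap)
  also have "\<dots> = (\<Sum>k<d. \<Sum>i<n. \<Sum>j<n. \<Sum>a\<in>L. (if c i = a then V i k else 0) * (if c j = a then V j k else 0))"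
    by (rule sum.cong[OF refl], rule sum.cong[OF refl], rule sum.swap)
  also have "\<dots> = (\<Sum>k<d. \<Sum>i<n. \<Sum>j<n. if c i = c j then V i k * V j k else 0)"
    by (intro sum.cong refl) (use delta in auto)
  also have "\<dots> = (\<Sum>i<n. \<Sum>k<d. \<Sum>j<n. if c i = c j then V i k * V j k else 0)"
    by (rule sum.swap)
  also have "\<dots> = (\<Sum>i<n. \<Sum>j<n. \<Sum>k<d. if c i = c j then V i k * V j k else 0)"
    by (rule sum.cong[OF refl], rule sum.swap)
  also have "\<dots> = same_sum n (gram d V) c"
    unfolding same_sum_def gram_def by (intro sum.cong refl) auto
  finally show ?thesis by simp
qed

section \<open>Optimal partitions with at most d + 1 clusters\<close>

text \<open>Elimination of the last coordinate: a pivot \<open>z\<close> clears it from all other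
  vectors, the induction hypothesis applies to these, and the coefficient of \<open>z\<close> is
  chosen to undo the subtraction. The vectors form an indexed family, so that repeated vectors are
  counted.\<close>

lemma linear_dependence:
  fixes w :: "'a \<Rightarrow> nat \<Rightarrow> real"
  assumes "finite A" "card A > d"
  shows "\<exists>l. (\<exists>a\<in>A. l a \<noteq> 0) \<and> (\<forall>k<d. (\<Sum>a\<in>A. l a * w a k) = 0)"
  using assms
proof (induction d arbitrary: A w)
  case 0
  then obtain a where "a \<in> A" by (metis card_gt_0_iff ex_in_conv)
  then show ?case by (intro exI[of _ "\<lambda>_. 1"]) auto
next
  case (Suc d)
  show ?case
  proof (cases "\<forall>a\<in>A. w a d = 0")
    case True
    from Suc.IH[of A w] Suc.prems obtain l where
      "\<exists>a\<in>A. l a \<noteq> 0" "\<forall>k<d. (\<Sum>a\<in>A. l a * w a k) = 0" by auto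
    with True show ?thesis by (intro exI[of _ l]) (auto simp: less_Suc_eq)
  next
    case False
    then obtain z where z: "z \<in> A" "w z d \<noteq> 0" by auto
    let ?B = "A - {z}"
    let ?w = "\<lambda>a k. w a k - w a d / w z d * w z k"
    have "card ?B > d" "finite ?B" using Suc.prems z by auto
    from Suc.IH[OF this(2,1), of ?w] obtain l where
      l: "\<exists>a\<in>?B. l a \<noteq> 0" "\<forall>k<d. (\<Sum>a\<in>?B. l a * ?w a k) = 0" by blast
    define s where "s = (\<Sum>a\<in>?B. l a * (w a d / w z d))"
    define l' where "l' = l(z := - s)"
    have split: "(\<Sum>a\<in>A. l' a * w a k) = (\<Sum>a\<in>?B. l a * w a k) - s * w z k" for k
    proof -
      have "(\<Sum>a\<in>A. l' a * w a k) = l' z * w z k + (\<Sum>a\<in>?B. l' a * w a k)"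
        using z Suc.prems by (simp add: sum.remove)
      moreover have "(\<Sum>a\<in>?B. l' a * w a k) = (\<Sum>a\<in>?B. l a * w a k)"
        by (intro sum.cong) (auto simp: l'_def)
      ultimately show ?thesis by (simp add: l'_def)
    qed
    have red: "(\<Sum>a\<in>?B. l a * ?w a k) = (\<Sum>a\<in>?B. l a * w a k) - s * w z k" for k
      by (simp add: s_def sum_distrib_right right_diff_distrib sum_subtractf mult.assoc)
    have "(\<Sum>a\<in>A. l' a * w a k) = 0" if "k < Suc d" for k
    proof (cases "k = d")
      case True
      have "s * w z d = (\<Sum>a\<in>?B. l a * w a d)"
        using z by (simp add: s_def sum_distrib_right)
      then show ?thesis using True by (simp add: split)
    next
      case False
      then show ?thesis using that l(2) red[of k] by (simp add: split)
    qed
    moreover have "\<exists>a\<in>A. l' a \<noteq> 0" using l(1) by (auto simp: l'_def)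
    ultimately show ?thesis by blast
  qed
qed

text \<open>If all inner products were negative, set one vector \<open>x\<close> aside and take a
  linear dependence of the others. Moving its nonpositive terms to the other side writes one vector
  \<open>v\<close> in two ways, so that its squared norm is a nonnegative combination of negative
  inner products; hence \<open>v\<close> is zero. But \<open>v\<close> is also a nontrivial
  nonnegative combination of vectors with negative inner product with \<open>x\<close>.\<close>

lemma exists_pair_nonneg_inner:
  fixes w :: "'a \<Rightarrow> nat \<Rightarrow> real"
  assumes "finite L" "card L > Suc d"
  shows "\<exists>a\<in>L. \<exists>b\<in>L. a \<noteq> b \<and> (\<Sum>k<d. w a k * w b k) \<ge> 0"
proof (rule ccontr)
  assume "\<not> ?thesis"
  then have neg: "(\<Sum>k<d. w a k * w b k) < 0" if "a \<in> L" "b \<in> L" "a \<noteq> b" for a b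
    using that by force
  obtain x where x: "x \<in> L" using assms by fastforce
  let ?A = "L - {x}"
  have A: "finite ?A" "card ?A > d" using assms x by auto
  \<comment> \<open>A change of sign makes some coefficient positive, so that \<open>p\<close> below
    is nonempty.\<close>
  obtain l where l: "\<exists>a\<in>?A. l a > 0" "\<forall>k<d. (\<Sum>a\<in>?A. l a * w a k) = 0"
  proof -
    obtain m where m: "\<exists>a\<in>?A. m a \<noteq> 0" "\<forall>k<d. (\<Sum>a\<in>?A. m a * w a k) = 0"
      using linear_dependence[OF A] by blast
    show thesis
    proof (cases "\<exists>a\<in>?A. m a > 0")
      case True
      with m that show ?thesis by blast
    next
      case False
      with m(1) have "\<exists>a\<in>?A. - m a > 0" by force
      moreover have "\<forall>k<d. (\<Sum>a\<in>?A. - m a * w a k) = 0"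
        using m(2) by (simp add: sum_negf)
      ultimately show ?thesis by (rule that)
    qed
  qed
  define p where "p = {a \<in> ?A. l a > 0}"
  define q where "q = {a \<in> ?A. \<not> l a > 0}"
  define v where "v k = (\<Sum>a\<in>p. l a * w a k)" for k
  have pq: "finite p" "finite q" "?A = p \<union> q" "p \<inter> q = {}"
    using A by (auto simp: p_def q_def)
  have v2: "v k = (\<Sum>b\<in>q. - l b * w b k)" if "k < d" for k
  proof -
    have "0 = v k + (\<Sum>b\<in>q. l b * w b k)"
      using l(2) that pq by (simp add: v_def sum.union_disjoint)
    then show ?thesis by (simp add: sum_negf)
  qed
  have "(\<Sum>k<d. v k * v k) = (\<Sum>k<d. \<Sum>a\<in>p. \<Sum>b\<in>q. (l a * w a k) * (- l b * w b k))"
  proof (intro sum.cong refl)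
    fix k assume "k \<in> {..<d}"
    then have "v k * v k = (\<Sum>a\<in>p. l a * w a k) * (\<Sum>b\<in>q. - l b * w b k)"
      using v2[of k] v_def[of k] by simp
    then show "v k * v k = (\<Sum>a\<in>p. \<Sum>b\<in>q. (l a * w a k) * (- l b * w b k))"
      by (simp only: sum_product)
  qed
  also have "\<dots> = (\<Sum>a\<in>p. \<Sum>k<d. \<Sum>b\<in>q. (l a * w a k) * (- l b * w b k))"
    by (rule sum.swap)
  also have "\<dots> = (\<Sum>a\<in>p. \<Sum>b\<in>q. \<Sum>k<d. (l a * w a k) * (- l b * w b k))"
    by (rule sum.cong[OF refl], rule sum.swap)
  also have "\<dots> = (\<Sum>a\<in>p. \<Sum>b\<in>q. (l a * - l b) * (\<Sum>k<d. w a k * w b k))"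
    unfolding sum_distrib_left by (intro sum.cong refl) (simp only: mult_ac)
  also have "\<dots> \<le> 0"
  proof (intro sum_nonpos)
    fix a b assume "a \<in> p" "b \<in> q"
    then have "a \<in> L" "b \<in> L" "a \<noteq> b" "l a > 0" "l b \<le> 0" by (auto simp: p_def q_def)
    then have "(\<Sum>k<d. w a k * w b k) < 0" "l a * - l b \<ge> 0"
      by (auto intro: neg simp: mult_nonneg_nonpos)
    then show "(l a * - l b) * (\<Sum>k<d. w a k * w b k) \<le> 0"
      by (intro mult_nonneg_nonpos) auto
  qed
  finally have "(\<Sum>k<d. v k * v k) = 0"
    using sum_nonneg[of "{..<d}" "\<lambda>k. v k * v k"] by simp
  then have v0: "v k = 0" if "k < d" for k
    using that sum_nonneg_eq_0_iff[of "{..<d}" "\<lambda>k. v k * v k"] by simp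
  have "0 = (\<Sum>k<d. v k * w x k)" by (simp add: v0)
  also have "\<dots> = (\<Sum>a\<in>p. l a * (\<Sum>k<d. w a k * w x k))"
    unfolding v_def sum_distrib_left sum_distrib_right
    by (subst sum.swap) (simp only: mult.assoc)
  also have "\<dots> < 0"
  proof -
    obtain a where "a \<in> p" using l(1) by (auto simp: p_def)
    moreover have "l a * (\<Sum>k<d. w a k * w x k) < 0" if "a \<in> p" for a
      using that x by (intro mult_pos_neg neg) (auto simp: p_def)
    ultimately show ?thesis
      using sum_strict_mono[OF pq(1), of "\<lambda>a. l a * (\<Sum>k<d. w a k * w x k)" "\<lambda>_. 0"] by auto
  qed
  finally show False by simp
qed

text \<open>Induction on the number of available labels: while there are more than
  \<open>d + 1\<close>, two clusters are merged, and the remaining labels are finally renamed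
  injectively. The bound on \<open>f\<close> also holds beyond \<open>n\<close>, where
  \<open>f\<close> is \<open>0\<close>; this spares side conditions later.\<close>

lemma few_clusters_suffice:
  fixes c :: "nat \<Rightarrow> nat"
  shows "\<exists>f::nat \<Rightarrow> nat. (\<forall>i. f i \<le> d) \<and> same_sum n (gram d V) c \<le> same_sum n (gram d V) f"
proof -
  have "\<exists>f::nat \<Rightarrow> nat. (\<forall>i. f i \<le> d) \<and> same_sum n (gram d V) c \<le> same_sum n (gram d V) f"
    if "finite L" "c ` {..<n} \<subseteq> L" for L
    using that
  proof (induction "card L" arbitrary: L c rule: less_induct)
    case less
    show ?case
    proof (cases "card L > Suc d")
      case True
      obtain a b where ab: "a \<in> L" "b \<in> L" "a \<noteq> b"
        and ge: "(\<Sum>k<d. csum n V c a k * csum n V c b k) \<ge> 0"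
        using exists_pair_nonneg_inner[OF less.prems(1) True, of "csum n V c"] by blast
      define c' where "c' = (\<lambda>i. if c i = b then a else c i)"
      let ?L = "L - {b}"
      have sub: "c' ` {..<n} \<subseteq> ?L" using less.prems ab by (auto simp: c'_def)
      have Wa: "csum n V c' a k = csum n V c a k + csum n V c b k" for k
        unfolding csum_def sum.distrib[symmetric]
        using ab by (intro sum.cong) (auto simp: c'_def)
      have Wo: "csum n V c' x k = csum n V c x k" if "x \<noteq> a" "x \<noteq> b" for x k
        unfolding csum_def using that by (intro sum.cong) (auto simp: c'_def)
      have fin: "finite L" "finite ?L" "finite (?L - {a})" using less.prems by auto
      have "same_sum n (gram d V) c'
          = (\<Sum>k<d. (csum n V c' a k)\<^sup>2) + (\<Sum>x\<in>?L - {a}. \<Sum>k<d. (csum n V c' x k)\<^sup>2)"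
        unfolding same_sum_gram[OF fin(2) sub] using fin ab by (intro sum.remove) auto
      also have "\<dots> = (\<Sum>k<d. (csum n V c a k + csum n V c b k)\<^sup>2)
          + (\<Sum>x\<in>?L - {a}. \<Sum>k<d. (csum n V c x k)\<^sup>2)"
        using Wa Wo by simp
      finally have 1: "same_sum n (gram d V) c' = \<dots>" .
      have "same_sum n (gram d V) c
          = (\<Sum>k<d. (csum n V c b k)\<^sup>2) + ((\<Sum>k<d. (csum n V c a k)\<^sup>2)
          + (\<Sum>x\<in>?L - {a}. \<Sum>k<d. (csum n V c x k)\<^sup>2))"
        unfolding same_sum_gram[OF less.prems] using fin ab
        by (simp add: sum.remove[of L b] sum.remove[of ?L a])
      moreover have "(\<Sum>k<d. (csum n V c a k + csum n V c b k)\<^sup>2)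
         = (\<Sum>k<d. (csum n V c a k)\<^sup>2) + (\<Sum>k<d. (csum n V c b k)\<^sup>2)
         + 2 * (\<Sum>k<d. csum n V c a k * csum n V c b k)"
        by (simp add: power2_sum sum.distrib sum_distrib_left mult.assoc)
      ultimately have "same_sum n (gram d V) c \<le> same_sum n (gram d V) c'"
        using 1 ge by simp
      moreover have "card ?L < card L" using ab fin by (intro psubset_card_mono) auto
      ultimately show ?thesis
        using less.hyps[OF _ fin(2) sub] by (meson order_trans)
    next
      case False
      then obtain g where g: "g ` L \<subseteq> {..d}" "inj_on g L"
        using card_le_inj[of L "{..d}"] less.prems by auto
      let ?f = "\<lambda>i. if i < n then g (c i) else 0"
      have "same_sum n (gram d V) ?f = same_sum n (gram d V) (g \<circ> c)"
        by (simp add: same_sum_def)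
      also have "\<dots> = same_sum n (gram d V) c"
        using g less.prems by (intro same_sum_inj) (auto intro: inj_on_subset)
      finally show ?thesis
        using g less.prems by (intro exI[of _ ?f]) auto
    qed
  qed
  then show ?thesis by blast
qed

lemma finite_arg_min:
  fixes g :: "'a \<Rightarrow> real"
  assumes "finite A" "A \<noteq> {}"
  shows "\<exists>u\<in>A. \<forall>x\<in>A. g u \<le> g x"
  using ex_is_arg_min_if_finite[OF assms, of g] by (fastforce simp: is_arg_min_def not_less)

lemma exists_optimal_labelling:
  "\<exists>f::nat \<Rightarrow> nat. (\<forall>i. f i \<le> d) \<and>
     (\<forall>g::nat \<Rightarrow> nat. same_sum n (gram d V) g \<le> same_sum n (gram d V) f)"
proof -
  \<comment> \<open>Only the values below \<open>n\<close> matter; prescribing \<open>0\<close>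
    elsewhere leaves a finite set in which a maximum exists.\<close>
  let ?F = "{f :: nat \<Rightarrow> nat. \<forall>i. (i \<in> {..<n} \<longrightarrow> f i \<in> {..d}) \<and> (i \<notin> {..<n} \<longrightarrow> f i = 0)}"
  let ?s = "same_sum n (gram d V)"
  have fin: "finite ?F" by (intro finite_set_of_finite_funs) auto
  have ne: "?F \<noteq> {}" by (auto intro!: exI[of _ "\<lambda>_. 0"])
  obtain f where f: "f \<in> ?F" "\<And>g. g \<in> ?F \<Longrightarrow> ?s g \<le> ?s f"
    using finite_arg_min[OF fin ne, of "\<lambda>f. - ?s f"] unfolding neg_le_iff_le by blast
  have "?s g \<le> ?s f" for g :: "nat \<Rightarrow> nat"
  proof -
    obtain h where h: "\<forall>i. h i \<le> d" "?s g \<le> ?s h"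
      using few_clusters_suffice[where d = d] by blast
    let ?h = "\<lambda>i. if i < n then h i else (0::nat)"
    have "?s ?h = ?s h" by (simp add: same_sum_def)
    moreover have "?h \<in> ?F" using h by simp
    ultimately show ?thesis using f(2)[of ?h] h(2) by simp
  qed
  moreover have "f i \<le> d" for i using f(1) by (cases "i < n") auto
  ultimately show ?thesis by blast
qed

text \<open>Moving point \<open>i\<close> to \<open>b\<close> changes the sum of squares by twice
  the left side minus twice the right side. The squared norm comes from the point's interaction with
  itself, and it makes the separation strict for nonzero points.\<close>

lemma optimal_labelling_separates:
  fixes f :: "nat \<Rightarrow> nat"
  assumes f: "\<And>i. f i \<le> d"
    and opt: "\<And>g::nat \<Rightarrow> nat. same_sum n (gram d V) g \<le> same_sum n (gram d V) f"
    and i: "i < n" and b: "b \<le> d" "b \<noteq> f i"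
  shows "(\<Sum>k<d. (V i k)\<^sup>2) \<le> (\<Sum>k<d. V i k * (csum n V f (f i) k - csum n V f b k))"
proof -
  let ?g = "f(i := b)"
  let ?W = "csum n V f"
  have upd: "csum n V ?g a k
      = ?W a k + (if a = b then V i k else 0) - (if a = f i then V i k else 0)" for a k
  proof -
    have "csum n V h a k = (if h i = a then V i k else 0)
        + (\<Sum>j\<in>{..<n} - {i}. if h j = a then V j k else 0)" for h :: "nat \<Rightarrow> nat"
      unfolding csum_def using i by (intro sum.remove) auto
    from this[of f] this[of ?g] show ?thesis using b by auto
  qed
  have part: "same_sum n (gram d V) h = (\<Sum>k<d. (csum n V h (f i) k)\<^sup>2)
      + ((\<Sum>k<d. (csum n V h b k)\<^sup>2) + (\<Sum>a\<in>{..d} - {f i} - {b}. \<Sum>k<d. (csum n V h a k)\<^sup>2))"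
    if "\<And>i. h i \<le> d" for h :: "nat \<Rightarrow> nat"
  proof -
    have "same_sum n (gram d V) h = (\<Sum>a\<in>{..d}. \<Sum>k<d. (csum n V h a k)\<^sup>2)"
      using that by (intro same_sum_gram) auto
    then show ?thesis
      using f[of i] b by (simp add: sum.remove[of "{..d}" "f i"] sum.remove[of "{..d} - {f i}" b])
  qed
  have "(\<Sum>k<d. (csum n V ?g (f i) k)\<^sup>2) + (\<Sum>k<d. (csum n V ?g b k)\<^sup>2)
      \<le> (\<Sum>k<d. (?W (f i) k)\<^sup>2) + (\<Sum>k<d. (?W b k)\<^sup>2)"
  proof -
    have "(\<Sum>a\<in>{..d} - {f i} - {b}. \<Sum>k<d. (csum n V ?g a k)\<^sup>2)
        = (\<Sum>a\<in>{..d} - {f i} - {b}. \<Sum>k<d. (?W a k)\<^sup>2)"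
      by (intro sum.cong) (auto simp: upd)
    moreover have "\<And>j. ?g j \<le> d" using f b by simp
    ultimately show ?thesis
      using opt[of ?g] part[of ?g] part[of f] f by simp
  qed
  moreover have "(\<Sum>k<d. (csum n V ?g (f i) k)\<^sup>2) + (\<Sum>k<d. (csum n V ?g b k)\<^sup>2)
     = (\<Sum>k<d. (?W (f i) k)\<^sup>2) + (\<Sum>k<d. (?W b k)\<^sup>2)
       + 2 * (\<Sum>k<d. (V i k)\<^sup>2) - 2 * (\<Sum>k<d. V i k * (?W (f i) k - ?W b k))"
    using b by (simp add: upd power2_eq_square algebra_simps sum.distrib sum_subtractf sum_distrib_left)
  ultimately show ?thesis by simp
qed

section \<open>Sign patterns from eliminations\<close>

text \<open>The restriction of the linear functional \<open>h\<close> to the hyperplane on which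
  \<open>u\<close> vanishes, written without coordinate \<open>p\<close>, which is solved for
  there.\<close>

definition elim :: "(nat \<Rightarrow> real) \<Rightarrow> nat \<Rightarrow> (nat \<Rightarrow> real) \<Rightarrow> nat \<Rightarrow> real" where
  "elim u p h = (\<lambda>q. h q - h p / u p * u q)"

text \<open>The walls form a flag: each later wall is first restricted to the earlier ones. The
  deepest level, where one coordinate \<open>l\<close> with sign \<open>s\<close> is left, decides
  first. If it gives zero, the tie is broken one level up by \<open>h p / u p\<close>, which is the
  factor when \<open>h\<close> is a multiple of \<open>u\<close>.\<close>

function lexval :: "nat \<Rightarrow> real \<Rightarrow> ((nat \<Rightarrow> real) \<times> nat) list \<Rightarrow> (nat \<Rightarrow> real) \<Rightarrow> real" where
  "lexval l s [] h = s * h l"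
| "lexval l s ((u, p) # us) h =
     (let x = lexval l s (map (\<lambda>(u', p'). (elim u p u', p')) us) (elim u p h)
      in if x \<noteq> 0 then x else h p / u p)"
  by pat_completeness auto
termination by (relation "measure (\<lambda>(l, s, us, h). length us)") auto

text \<open>Comparing \<open>a\<close> with \<open>b\<close> and \<open>b\<close> with
  \<open>a\<close> uses opposite vectors; oddness ensures that at most one of the two labels
  wins.\<close>

lemma lexval_uminus: "lexval l s us (\<lambda>q. - h q) = - lexval l s us h"
proof (induction l s us h rule: lexval.induct)
  case (2 l s u p us h)
  have "elim u p (\<lambda>q. - h q) = (\<lambda>q. - elim u p h q)"
    by (auto simp: elim_def)
  with 2 show ?case by (simp add: Let_def)
qed simp

lemma lexval_zero: "lexval l s us (\<lambda>q. 0) = 0"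
  using lexval_uminus[of l s us "\<lambda>q. 0"] by simp

text \<open>A real vector space is not a finite union of hyperplanes: a vector that avoids the old
  ones is perturbed in the direction \<open>w\<close>.\<close>

lemma generic_vector:
  fixes W :: "(nat \<Rightarrow> real) set"
  assumes "finite W" "finite S" "\<And>w. w \<in> W \<Longrightarrow> \<exists>q\<in>S. w q \<noteq> 0"
  shows "\<exists>z. \<forall>w\<in>W. (\<Sum>q\<in>S. w q * z q) \<noteq> 0"
  using assms(1,3)
proof (induction W rule: finite_induct)
  case (insert w W)
  then obtain z where z: "\<forall>w\<in>W. (\<Sum>q\<in>S. w q * z q) \<noteq> 0" by auto
  define dot where "dot a b = (\<Sum>q\<in>S. a q * b q)" for a b :: "nat \<Rightarrow> real"
  \<comment> \<open>These are the only parameters at which the perturbed vector can fall on a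
    hyperplane that it could avoid.\<close>
  have "finite ((\<lambda>x. - dot x z / dot x w) ` insert w W)" using insert.hyps by simp
  then obtain e where e: "e \<notin> (\<lambda>x. - dot x z / dot x w) ` insert w W"
    using ex_new_if_finite[OF infinite_UNIV_char_0] by blast
  have lin: "(\<Sum>q\<in>S. x q * (z q + e * w q)) = dot x z + e * dot x w" for x
    by (simp add: dot_def sum_distrib_left sum.distrib[symmetric] algebra_simps)
  have "dot w w \<noteq> 0"
    using insert.prems[of w] assms(2) by (auto simp: dot_def sum_nonneg_eq_0_iff)
  have "(\<Sum>q\<in>S. x q * (z q + e * w q)) \<noteq> 0" if x: "x \<in> insert w W" for x
  proof (cases "dot x w = 0")
    case True
    then show ?thesis using x z \<open>dot w w \<noteq> 0\<close> by (auto simp: lin) (auto simp: dot_def)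
  next
    case False
    have "e \<noteq> - dot x z / dot x w" using e x by blast
    then show ?thesis unfolding lin using False by (auto simp: field_simps)
  qed
  then show ?case by (intro exI[of _ "\<lambda>q. z q + e * w q"]) blast
qed simp

lemma list_in_image:
  assumes "set ys \<subseteq> f ` Q"
  shows "\<exists>xs. set xs \<subseteq> Q \<and> ys = map f xs"
  using assms
proof (induction ys)
  case (Cons y ys)
  then obtain x xs where "set xs \<subseteq> Q" "ys = map f xs" "x \<in> Q" "y = f x" by auto
  then show ?case by (intro exI[of _ "x # xs"]) auto
qed simp

text \<open>The closed cone on which all vectors of \<open>P\<close> are nonnegative contains \<open>c\<close> in its interior. Moving
  from \<open>c\<close> in a generic direction, the first wall \<open>u\<close> is hit at a point where only the multiples of
  \<open>u\<close> vanish, and the argument is repeated within that wall.\<close>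
lemma lexval_realizes_cell:
  fixes P Q :: "(nat \<Rightarrow> real) set" and c :: "nat \<Rightarrow> real"
  assumes "finite S" "card S = Suc m" "finite P" "P \<subseteq> Q" "Q \<noteq> {}"
    and "\<And>h q. h \<in> P \<Longrightarrow> q \<notin> S \<Longrightarrow> h q = 0"
    and "\<And>h. h \<in> P \<Longrightarrow> (\<Sum>q\<in>S. h q * c q) > 0"
  shows "\<exists>us l s. length us = m \<and> fst ` set us \<subseteq> Q \<and> snd ` set us \<subseteq> S \<and> l \<in> S \<and>
           s \<in> {1, -1} \<and> (\<forall>h\<in>P. lexval l s us h > 0)"
  using assms
proof (induction m arbitrary: S P Q c)
  case 0
  then obtain l where l: "S = {l}" by (auto simp: card_Suc_eq)
  let ?s = "if c l > 0 then 1 else -1 :: real"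
  have "lexval l ?s [] h > 0" if "h \<in> P" for h
    using "0.prems"(7)[OF that] l by (auto simp: zero_less_mult_iff)
  then show ?case using l by (intro exI[of _ "[]"] exI[of _ l] exI[of _ ?s]) auto
next
  case (Suc m)
  define dot where "dot a b = (\<Sum>q\<in>S. a q * b q)" for a b :: "nat \<Rightarrow> real"
  have pos: "dot h c > 0" if "h \<in> P" for h using Suc.prems(7)[OF that] by (simp add: dot_def)
  show ?case
  proof (cases "P = {}")
    case True
    obtain q where q: "q \<in> S" using Suc.prems(2) by (metis card.empty equals0I nat.distinct(1))
    obtain x where x: "x \<in> Q" using Suc.prems by auto
    \<comment> \<open>There is nothing to separate; the list is padding, because its length is
      prescribed.\<close>
    show ?thesis using True q x
      by (intro exI[of _ "replicate (Suc m) (x, q)"] exI[of _ q] exI[of _ 1]) auto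
  next
    case False
    \<comment> \<open>The combination of \<open>g\<close> and \<open>h\<close> orthogonal to
      \<open>c\<close>. It vanishes on \<open>S\<close> exactly when \<open>g\<close> and
      \<open>h\<close> are parallel; otherwise a direction not orthogonal to it meets the two walls
      at different times.\<close>
    define w where "w g h = (\<lambda>q. dot h c * g q - dot g c * h q)" for g h
    define par where "par g h \<longleftrightarrow> (\<forall>q\<in>S. w g h q = 0)" for g h
    let ?W = "P \<union> {w g h |g h. g \<in> P \<and> h \<in> P \<and> \<not> par g h}"
    have "{w g h |g h. g \<in> P \<and> h \<in> P \<and> \<not> par g h} \<subseteq> (\<lambda>(g, h). w g h) ` (P \<times> P)" by auto
    then have finW: "finite ?W"
      using Suc.prems(3) finite_surj[of "P \<times> P"] by (simp add: finite_cartesian_product)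
    have nzW: "\<exists>q\<in>S. x q \<noteq> 0" if "x \<in> ?W" for x
    proof (cases "x \<in> P")
      case True
      show ?thesis
      proof (rule ccontr)
        assume "\<not> ?thesis"
        then have "dot x c = 0" by (simp add: dot_def)
        then show False using pos[OF True] by simp
      qed
    next
      case False
      then show ?thesis using that by (auto simp: par_def)
    qed
    obtain z0 where z0: "\<forall>x\<in>?W. dot x z0 \<noteq> 0"
      using generic_vector[OF finW Suc.prems(1) nzW] unfolding dot_def by blast
    \<comment> \<open>The walk goes along \<open>c - t * z\<close> with \<open>t > 0\<close>;
      replacing \<open>z0\<close> by its negative if necessary makes sure that some wall is
      met.\<close>
    obtain z where z: "\<And>x. x \<in> ?W \<Longrightarrow> dot x z \<noteq> 0" and zpos: "\<exists>h\<in>P. dot h z > 0"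
    proof -
      have neg: "dot x (\<lambda>q. - z0 q) = - dot x z0" for x by (simp add: dot_def sum_negf)
      obtain h where h: "h \<in> P" using False by auto
      show thesis
      proof (cases "dot h z0 > 0")
        case True
        then show ?thesis using that[of z0] z0 h by blast
      next
        case False
        then have "dot h (\<lambda>q. - z0 q) > 0" using z0 h neg by force
        then show ?thesis using that[of "\<lambda>q. - z0 q"] z0 h neg by auto
      qed
    qed
    let ?R = "{h \<in> P. dot h z > 0}"
    have finR: "finite ?R" "?R \<noteq> {}" using Suc.prems(3) zpos by auto
    obtain u where u: "u \<in> P" "dot u z > 0"
      and umin: "\<And>h. h \<in> P \<Longrightarrow> dot h z > 0 \<Longrightarrow> dot u c / dot u z \<le> dot h c / dot h z"
      using finite_arg_min[OF finR, of "\<lambda>h. dot h c / dot h z"] by blast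
    define t where "t = dot u c / dot u z"
    define c' where "c' = (\<lambda>q. c q - t * z q)"
    have dotc': "dot h c' = dot h c - t * dot h z" for h
      by (simp add: dot_def c'_def algebra_simps sum_subtractf sum_distrib_left)
    have uc': "dot u c' = 0" using u by (simp add: dotc' t_def)
    have tpos: "t > 0" using u pos by (simp add: t_def)
    have c'pos: "dot h c' > 0" if h: "h \<in> P" "\<not> par h u" for h
    proof (cases "dot h z > 0")
      case True
      \<comment> \<open>By genericity \<open>h\<close> does not vanish at the time \<open>t\<close>
        at which the first wall is hit.\<close>
      have "w h u \<in> ?W" using h u by blast
      then have "dot (w h u) z \<noteq> 0" by (rule z)
      moreover have "dot (w h u) z = dot u c * dot h z - dot h c * dot u z"
        by (simp add: dot_def w_def algebra_simps sum_subtractf sum_distrib_left)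
      ultimately have "t \<noteq> dot h c / dot h z"
        using True u by (auto simp: t_def field_simps)
      then have "t < dot h c / dot h z" using umin[OF h(1) True] by (simp add: t_def)
      then show ?thesis using True by (simp add: dotc' field_simps)
    next
      case False
      then have "t * dot h z \<le> 0" using tpos by (simp add: mult_nonneg_nonpos)
      then show ?thesis using pos[OF h(1)] by (simp add: dotc')
    qed
    obtain p where p: "p \<in> S" "u p \<noteq> 0" using nzW[of u] u by blast
    let ?e = "elim u p"
    let ?S = "S - {p}"
    \<comment> \<open>Functionals parallel to \<open>u\<close> vanish on the wall and are left to
      the tie-break; all others stay strictly positive at \<open>c'\<close>.\<close>
    let ?P = "?e ` {h \<in> P. \<not> par h u}"
    have "\<exists>us l s. length us = m \<and> fst ` set us \<subseteq> ?e ` Q \<and> snd ` set us \<subseteq> ?S \<and> l \<in> ?S \<and>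
           s \<in> {1, -1} \<and> (\<forall>h\<in>?P. lexval l s us h > 0)"
    proof (rule Suc.IH[where c = c'])
      show "finite ?S" "card ?S = Suc m" "finite ?P" "?P \<subseteq> ?e ` Q" "?e ` Q \<noteq> {}"
        using Suc.prems p by auto
      show "h q = 0" if "h \<in> ?P" "q \<notin> ?S" for h q
      proof (cases "q = p")
        case True
        then show ?thesis using that p by (auto simp: elim_def)
      next
        case False
        then have "q \<notin> S" using that by simp
        then have "u q = 0" "\<And>g. g \<in> P \<Longrightarrow> g q = 0" using Suc.prems(6) u(1) by blast+
        then show ?thesis using that by (auto simp: elim_def)
      qed
      show "(\<Sum>q\<in>?S. h q * c' q) > 0" if h: "h \<in> ?P" for h
      proof -
        obtain g where g: "g \<in> P" "\<not> par g u" "h = ?e g" using h by auto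
        have "h p = 0" using g p by (simp add: elim_def)
        then have "(\<Sum>q\<in>?S. h q * c' q) = dot h c'"
          using Suc.prems(1) p by (simp add: dot_def sum.remove[of S p])
        also have "\<dots> = dot g c' - g p / u p * dot u c'"
          unfolding g(3) elim_def dot_def
          by (simp add: left_diff_distrib sum_subtractf sum_distrib_left mult.assoc)
        finally show ?thesis using c'pos[OF g(1,2)] uc' by simp
      qed
    qed
    then obtain us l s where us: "length us = m" "fst ` set us \<subseteq> ?e ` Q" "snd ` set us \<subseteq> ?S"
      "l \<in> ?S" "s \<in> {1, -1}" "\<forall>h\<in>?P. lexval l s us h > 0"
      by (elim exE conjE) (rule that)
    \<comment> \<open>The walls found inside the hyperplane are restrictions of members of
      \<open>Q\<close>; lifting them back is what lets \<open>lexval\<close> redo the elimination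
      itself.\<close>
    have "set us \<subseteq> (\<lambda>(u', p'). (?e u', p')) ` (Q \<times> ?S)"
    proof
      fix x assume "x \<in> set us"
      then have "fst x \<in> ?e ` Q" and S: "snd x \<in> ?S" using us(2,3) by blast+
      then obtain v where "v \<in> Q" "fst x = ?e v" by blast
      then show "x \<in> (\<lambda>(u', p'). (?e u', p')) ` (Q \<times> ?S)"
        using S by (intro image_eqI[of _ _ "(v, snd x)"]) (auto simp: prod_eq_iff)
    qed
    from list_in_image[OF this] obtain vs where
      vs: "set vs \<subseteq> Q \<times> ?S" "us = map (\<lambda>(u', p'). (?e u', p')) vs" by blast
    \<comment> \<open>A vector parallel to \<open>u\<close> is a positive multiple of it, since both
      are positive at \<open>c\<close>: it is eliminated to zero and the tie-break returns the
      factor.\<close>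
    have "lexval l s ((u, p) # vs) h > 0" if h: "h \<in> P" for h
    proof (cases "par h u")
      case True
      have propl: "h q = dot h c / dot u c * u q" for q
      proof (cases "q \<in> S")
        case q: True
        then have "dot u c * h q = dot h c * u q" using True by (simp add: par_def w_def)
        then show ?thesis using pos[OF u(1)] by (simp add: field_simps)
      next
        case False
        then have "h q = 0" "u q = 0" using Suc.prems(6) h u(1) by blast+
        then show ?thesis by simp
      qed
      have ratio: "h p / u p = dot h c / dot u c" using propl[of p] p by simp
      have "?e h = (\<lambda>q. 0)" unfolding elim_def ratio using propl by auto
      then show ?thesis
        using pos[OF h] pos[OF u(1)] ratio by (simp add: lexval_zero)
    next
      case False
      then have "lexval l s us (?e h) > 0" using us(6) h by blast
      then show ?thesis by (simp add: vs(2)[symmetric])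
    qed
    then show ?thesis using us vs u p Suc.prems(4)
      by (intro exI[of _ "(u, p) # vs"] exI[of _ l] exI[of _ s]) auto
  qed
qed

section \<open>Candidate labellings\<close>

text \<open>With \<open>c\<close> the concatenation of vectors \<open>c\<^sub>0, \<dots>, c\<^sub>d\<^sub>-\<^sub>1\<close> of \<open>\<real>\<^sup>d\<close> and with
  \<open>c\<^sub>d = 0\<close>, the inner product of \<open>sepvec d a b v\<close> and \<open>c\<close> is that of \<open>v\<close> and \<open>c\<^sub>a - c\<^sub>b\<close>.\<close>
definition sepvec :: "nat \<Rightarrow> nat \<Rightarrow> nat \<Rightarrow> (nat \<Rightarrow> real) \<Rightarrow> nat \<Rightarrow> real" where
  "sepvec d a b v q = (if q < d * d \<and> q div d = a then v (q mod d) else 0)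
     - (if q < d * d \<and> q div d = b then v (q mod d) else 0)"

text \<open>The constant-size part of a candidate: for each wall two labels and the pivot coordinate, then the
  last coordinate and its sign. The points defining the walls are given separately, by \<open>ix\<close>.\<close>
type_synonym config = "(nat \<times> nat \<times> nat) list \<times> nat \<times> int"

definition configs :: "nat \<Rightarrow> config list" where
  "configs d = List.product (List.n_lists (d * d - 1)
     (List.product [0..<Suc d] (List.product [0..<Suc d] [0..<d * d])))
     (List.product [0..<d * d] [1, -1])"

text \<open>\<open>cs\<close> is kept apart from \<open>ix\<close> because it is compiled into the
  program, whereas \<open>ix\<close> is what the nested loops enumerate.\<close>

definition walls :: "nat \<Rightarrow> (nat \<Rightarrow> nat \<Rightarrow> real) \<Rightarrow> (nat \<times> nat \<times> nat) list \<Rightarrow> (nat \<Rightarrow> nat)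
    \<Rightarrow> ((nat \<Rightarrow> real) \<times> nat) list" where
  "walls d V cs ix = map (\<lambda>j. (sepvec d (fst (cs ! j)) (fst (snd (cs ! j))) (V (ix j)), snd (snd (cs ! j))))
     [0..<length cs]"

text \<open>Label \<open>0\<close> is the untested default: a bad candidate, for which no label
  wins, still gives a genuine labelling.\<close>

fun pick :: "(nat \<Rightarrow> bool) \<Rightarrow> nat \<Rightarrow> nat" where
  "pick Q 0 = 0"
| "pick Q (Suc m) = (if Q (Suc m) then Suc m else pick Q m)"

lemma pick_le: "pick Q m \<le> m"
  by (induction m) auto

lemma pick_unique:
  assumes "Q a" "a \<le> m" "\<And>b. b \<le> m \<Longrightarrow> Q b \<Longrightarrow> b = a"
  shows "pick Q m = a"
  using assms
proof (induction m)
  case (Suc m)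
  show ?case
  proof (cases "Q (Suc m)")
    case True
    moreover from this have "Suc m = a" by (intro Suc.prems(3)) simp
    ultimately show ?thesis by auto
  next
    case False
    then have "a \<le> m" using Suc.prems(1,2) by (metis le_SucE)
    then have "pick Q m = a" using Suc.prems(1,3) by (intro Suc.IH) auto
    then show ?thesis using False by simp
  qed
qed simp

fun labelling :: "nat \<Rightarrow> (nat \<Rightarrow> nat \<Rightarrow> real) \<Rightarrow> config \<Rightarrow> (nat \<Rightarrow> nat) \<Rightarrow> nat \<Rightarrow> nat" where
  "labelling d V (cs, l, s) ix i =
     pick (\<lambda>a. \<forall>b\<le>d. b \<noteq> a \<longrightarrow> lexval l (real_of_int s) (walls d V cs ix) (sepvec d a b (V i)) > 0) d"

lemma labelling_le: "labelling d V \<theta> ix i \<le> d"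
  by (cases \<theta>) (simp add: pick_le)

text \<open>Only differences of cluster sums matter, so \<open>W d\<close> may be subtracted from
  all of them. Block \<open>d\<close> is absent from \<open>sepvec\<close>, which agrees with its
  difference being zero.\<close>

lemma sepvec_inner:
  assumes "a \<le> d" "b \<le> d"
  shows "(\<Sum>q<d * d. sepvec d a b v q * (W (q div d) (q mod d) - W d (q mod d)))
     = (\<Sum>k<d. v k * (W a k - W b k))"
proof -
  have half: "(\<Sum>m<d. \<Sum>k<d. (if m = a then v k else 0) * (W m k - W d k))
      = (\<Sum>k<d. v k * (W a k - W d k))" if "a \<le> d" for a
  proof -
    have "(\<Sum>m<d. \<Sum>k<d. (if m = a then v k else 0) * (W m k - W d k))
       = (\<Sum>m<d. if m = a then \<Sum>k<d. v k * (W a k - W d k) else 0)"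
      by (intro sum.cong) auto
    also have "\<dots> = (\<Sum>k<d. v k * (W a k - W d k))"
      using that by (cases "a = d") (auto simp: sum.delta)
    finally show ?thesis .
  qed
  have "(\<Sum>q<d * d. sepvec d a b v q * (W (q div d) (q mod d) - W d (q mod d)))
     = (\<Sum>q<d * d. (\<lambda>m k. ((if m = a then v k else 0) - (if m = b then v k else 0)) * (W m k - W d k))
         (q div d) (q mod d))"
    by (intro sum.cong) (auto simp: sepvec_def)
  also have "\<dots> = (\<Sum>m<d. \<Sum>k<d. ((if m = a then v k else 0) - (if m = b then v k else 0)) * (W m k - W d k))"
    by (rule sum_divmod)
  also have "\<dots> = (\<Sum>m<d. \<Sum>k<d. (if m = a then v k else 0) * (W m k - W d k))
     - (\<Sum>m<d. \<Sum>k<d. (if m = b then v k else 0) * (W m k - W d k))"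
    by (simp only: left_diff_distrib sum_subtractf)
  also have "\<dots> = (\<Sum>k<d. v k * (W a k - W b k))"
    by (simp only: half assms) (simp add: sum_subtractf[symmetric] algebra_simps)
  finally show ?thesis .
qed

lemma some_labelling_optimal:
  assumes d: "d \<ge> 1" and n: "n \<ge> 1"
  shows "\<exists>\<theta> ix. \<theta> \<in> set (configs d) \<and> (\<forall>j. ix j < n) \<and>
    (\<forall>g::nat \<Rightarrow> nat. same_sum n (gram d V) g \<le> same_sum n (gram d V) (labelling d V \<theta> ix))"
proof -
  obtain f :: "nat \<Rightarrow> nat" where f: "\<And>i. f i \<le> d"
    and opt: "\<And>g::nat \<Rightarrow> nat. same_sum n (gram d V) g \<le> same_sum n (gram d V) f"
    using exists_optimal_labelling[of d n V] by blast
  define W where "W = csum n V f"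
  define c where "c q = W (q div d) (q mod d) - W d (q mod d)" for q
  define Q where "Q = (\<lambda>(i, a, b). sepvec d a b (V i)) ` ({..<n} \<times> {..d} \<times> {..d})"
  \<comment> \<open>Zero points are left out, since no strict inequality holds for them.\<close>
  define P where "P = (\<lambda>(i, a, b). sepvec d a b (V i)) `
     {(i, a, b). i < n \<and> a = f i \<and> b \<le> d \<and> b \<noteq> f i \<and> (\<exists>k<d. V i k \<noteq> 0)}"
  have PQ: "P \<subseteq> Q" unfolding P_def Q_def using f by (intro image_mono) auto
  have finP: "finite P" by (rule finite_subset[OF PQ]) (simp add: Q_def)
  have Qne: "Q \<noteq> {}" using n by (auto simp: Q_def lessThan_empty_iff)
  have supp: "h q = 0" if "h \<in> P" "q \<notin> {..<d * d}" for h q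
    using that by (auto simp: P_def sepvec_def)
  have pos: "(\<Sum>q\<in>{..<d * d}. h q * c q) > 0" if "h \<in> P" for h
  proof -
    obtain i b k where h: "h = sepvec d (f i) b (V i)" "i < n" "b \<le> d" "b \<noteq> f i" "k < d" "V i k \<noteq> 0"
      using \<open>h \<in> P\<close> by (auto simp: P_def)
    have "0 < (\<Sum>k<d. (V i k)\<^sup>2)"
      using h by (intro sum_pos2[of _ k]) auto
    also have "\<dots> \<le> (\<Sum>k<d. V i k * (W (f i) k - W b k))"
      unfolding W_def using f opt h by (intro optimal_labelling_separates) auto
    also have "\<dots> = (\<Sum>q<d * d. h q * c q)"
      unfolding h(1) c_def by (rule sepvec_inner[symmetric]) (use f h in auto)
    finally show ?thesis .
  qed
  have dd: "card {..<d * d} = Suc (d * d - 1)" using d by simp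
  obtain us l s where us: "length us = d * d - 1" "fst ` set us \<subseteq> Q" "snd ` set us \<subseteq> {..<d * d}"
    "l \<in> {..<d * d}" "s \<in> {1, -1 :: real}" and lex: "\<forall>h\<in>P. lexval l s us h > 0"
    using lexval_realizes_cell[OF finite_lessThan dd finP PQ Qne, of c] supp pos by blast
  have "set us \<subseteq> (\<lambda>(i, a, b, p). (sepvec d a b (V i), p)) ` ({..<n} \<times> {..d} \<times> {..d} \<times> {..<d * d})"
  proof
    fix x assume "x \<in> set us"
    then have "fst x \<in> Q" and p: "snd x \<in> {..<d * d}" using us(2,3) by blast+
    then obtain i a b where "i < n" "a \<le> d" "b \<le> d" "fst x = sepvec d a b (V i)"
      unfolding Q_def by auto
    then show "x \<in> (\<lambda>(i, a, b, p). (sepvec d a b (V i), p)) ` ({..<n} \<times> {..d} \<times> {..d} \<times> {..<d * d})"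
      using p by (intro image_eqI[of _ _ "(i, a, b, snd x)"]) (auto simp: prod_eq_iff)
  qed
  from list_in_image[OF this] obtain vs where
    vs: "set vs \<subseteq> {..<n} \<times> {..d} \<times> {..d} \<times> {..<d * d}"
      "us = map (\<lambda>(i, a, b, p). (sepvec d a b (V i), p)) vs" by blast
  define cs where "cs = map snd vs"
  define ix where "ix j = (if j < length vs then fst (vs ! j) else 0)" for j
  define \<theta> :: config where "\<theta> = (cs, l, if s = 1 then 1 else -1)"
  have walls: "walls d V cs ix = us"
    by (rule nth_equalityI) (auto simp: walls_def cs_def vs(2) ix_def case_prod_beta)
  have sval: "real_of_int (if s = 1 then 1 else -1) = s" using us(5) by auto
  have "set cs \<subseteq> {..d} \<times> {..d} \<times> {..<d * d}" using vs(1) by (auto simp: cs_def)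
  moreover have "length cs = d * d - 1" using us(1) by (simp add: cs_def vs(2))
  ultimately have "\<theta> \<in> set (configs d)"
    using us(4) by (auto simp: \<theta>_def configs_def set_n_lists less_Suc_eq_le)
  moreover have "ix j < n" for j
  proof (cases "j < length vs")
    case True
    then have "vs ! j \<in> {..<n} \<times> {..d} \<times> {..d} \<times> {..<d * d}" using vs(1) nth_mem by blast
    then show ?thesis using True by (auto simp: ix_def)
  qed (use n in \<open>simp add: ix_def\<close>)
  moreover have "same_sum n (gram d V) (labelling d V \<theta> ix) = same_sum n (gram d V) f"
  proof -
    have lab: "labelling d V \<theta> ix i = f i" if i: "i < n" "k < d" "V i k \<noteq> 0" for i k
    proof -
      have win: "lexval l s us (sepvec d (f i) b (V i)) > 0" if "b \<le> d" "b \<noteq> f i" for b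
      proof -
        have "sepvec d (f i) b (V i) \<in> P"
          unfolding P_def using i that by (intro image_eqI[of _ _ "(i, f i, b)"]) auto
        then show ?thesis using lex by blast
      qed
      have anti: "sepvec d b a v = (\<lambda>q. - sepvec d a b v q)" for a b v
        by (auto simp: sepvec_def)
      show ?thesis
        unfolding \<theta>_def labelling.simps walls sval
      proof (rule pick_unique)
        show "\<forall>b\<le>d. b \<noteq> f i \<longrightarrow> 0 < lexval l s us (sepvec d (f i) b (V i))" using win by blast
        show "f i \<le> d" by (rule f)
        \<comment> \<open>Two different labels cannot both win, because their mutual comparison is
          antisymmetric.\<close>
        fix b assume "b \<le> d" and b: "\<forall>ba\<le>d. ba \<noteq> b \<longrightarrow> 0 < lexval l s us (sepvec d b ba (V i))"
        show "b = f i"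
        proof (rule ccontr)
          assume "b \<noteq> f i"
          then have "0 < lexval l s us (sepvec d b (f i) (V i))" using b f by simp
          also have "\<dots> = - lexval l s us (sepvec d (f i) b (V i))"
            by (subst anti) (rule lexval_uminus)
          finally show False using win[OF \<open>b \<le> d\<close> \<open>b \<noteq> f i\<close>] by simp
        qed
      qed
    qed
    \<comment> \<open>The labels may differ at zero points, which add nothing to any
      coordinate.\<close>
    have "csum n V (labelling d V \<theta> ix) a k = csum n V f a k" if "k < d" for a k
      unfolding csum_def
    proof (intro sum.cong refl)
      fix i assume "i \<in> {..<n}"
      then show "(if labelling d V \<theta> ix i = a then V i k else 0) = (if f i = a then V i k else 0)"
        using lab[of i k] that by (cases "V i k = 0") auto
    qed
    then have "(\<Sum>a\<in>{..d}. \<Sum>k<d. (csum n V (labelling d V \<theta> ix) a k)\<^sup>2)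
       = (\<Sum>a\<in>{..d}. \<Sum>k<d. (csum n V f a k)\<^sup>2)" by simp
    moreover have "same_sum n (gram d V) (labelling d V \<theta> ix)
       = (\<Sum>a\<in>{..d}. \<Sum>k<d. (csum n V (labelling d V \<theta> ix) a k)\<^sup>2)"
      by (rule same_sum_gram) (auto simp: labelling_le)
    moreover have "same_sum n (gram d V) f = (\<Sum>a\<in>{..d}. \<Sum>k<d. (csum n V f a k)\<^sup>2)"
      by (rule same_sum_gram) (auto simp: f)
    ultimately show ?thesis by simp
  qed
  ultimately show ?thesis using opt by (intro exI[of _ \<theta>] exI[of _ ix]) auto
qed


section \<open>Structured programs\<close>

type_synonym mem = "(nat \<Rightarrow> int) \<times> (nat \<Rightarrow> real)"

datatype com =
    Skip
  | Do instr
  | Seq com com (infixr ";;" 60)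
  | IfRLe nat nat com com
  | While nat nat com

fun clen :: "com \<Rightarrow> nat" where
  "clen Skip = 0"
| "clen (Do i) = 1"
| "clen (c1 ;; c2) = clen c1 + clen c2"
| "clen (IfRLe a b c1 c2) = clen c1 + clen c2 + 2"
| "clen (While a b c) = clen c + 2"

text \<open>The second argument is the address at which the code is placed. \<open>While a b c\<close> repeats \<open>c\<close> as
  long as integer register \<open>a\<close> is less than integer register \<open>b\<close>.\<close>
fun comp :: "com \<Rightarrow> nat \<Rightarrow> instr list" where
  "comp Skip p = []"
| "comp (Do i) p = [i]"
| "comp (c1 ;; c2) p = comp c1 p @ comp c2 (p + clen c1)"
| "comp (IfRLe a b c1 c2) p = JmpRLe a b (p + clen c2 + 2) # comp c2 (Suc p)
     @ Jmp (p + clen c1 + clen c2 + 2) # comp c1 (p + clen c2 + 2)"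
| "comp (While a b c) p = JmpILe b a (p + clen c + 2) # comp c (Suc p) @ [Jmp p]"

lemma length_comp [simp]: "length (comp c p) = clen c"
  by (induction c arbitrary: p) auto

definition mk :: "nat \<Rightarrow> mem \<Rightarrow> state" where
  "mk p s = \<lparr>pc = p, ireg = fst s, rreg = snd s\<rparr>"

definition loaded :: "instr list \<Rightarrow> nat \<Rightarrow> instr list \<Rightarrow> bool" where
  "loaded P p xs \<longleftrightarrow> (\<exists>ys zs. P = ys @ xs @ zs \<and> length ys = p)"

lemma loaded_Cons:
  assumes "loaded P p (x # xs)"
  shows "p < length P" "P ! p = x" "loaded P (Suc p) xs"
proof -
  obtain ys zs where *: "P = ys @ (x # xs) @ zs" "length ys = p"
    using assms by (auto simp: loaded_def)
  then show "p < length P" "P ! p = x" by (auto simp: nth_append)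
  show "loaded P (Suc p) xs"
    unfolding loaded_def using * by (intro exI[of _ "ys @ [x]"] exI[of _ zs]) auto
qed

lemma loaded_append:
  assumes "loaded P p (xs @ ys)"
  shows "loaded P p xs" "loaded P (p + length xs) ys"
proof -
  obtain us zs where *: "P = us @ (xs @ ys) @ zs" "length us = p"
    using assms by (auto simp: loaded_def)
  show "loaded P p xs"
    unfolding loaded_def using * by (intro exI[of _ us] exI[of _ "ys @ zs"]) auto
  show "loaded P (p + length xs) ys"
    unfolding loaded_def using * by (intro exI[of _ "us @ xs"] exI[of _ zs]) auto
qed

fun straight :: "instr \<Rightarrow> bool" where
  "straight (JmpILe a b l) = False"
| "straight (JmpRLe a b l) = False"
| "straight (Jmp l) = False"
| "straight Halt = False"
| "straight i = True"

definition iex :: "instr \<Rightarrow> mem \<Rightarrow> mem" where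
  "iex i s = (ireg (exec i (mk 0 s)), rreg (exec i (mk 0 s)))"

lemma iex_simps [simp]:
  "iex (IConst r k) (I, R) = (I(r := k), R)"
  "iex (IAdd r a b) (I, R) = (I(r := I a + I b), R)"
  "iex (ISub r a b) (I, R) = (I(r := I a - I b), R)"
  "iex (ILoad r a) (I, R) = (I(r := I (nat (I a))), R)"
  "iex (IStore a r) (I, R) = (I(nat (I a) := I r), R)"
  "iex (RConst r k) (I, R) = (I, R(r := of_int k))"
  "iex (RAdd r a b) (I, R) = (I, R(r := R a + R b))"
  "iex (RSub r a b) (I, R) = (I, R(r := R a - R b))"
  "iex (RMul r a b) (I, R) = (I, R(r := R a * R b))"
  "iex (RDiv r a b) (I, R) = (I, R(r := R a / R b))"
  "iex (RLoad r a) (I, R) = (I, R(r := R (nat (I a))))"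
  "iex (RStore a r) (I, R) = (I, R(nat (I a) := R r))"
  by (simp_all add: iex_def mk_def)

lemma exec_straight: "straight i \<Longrightarrow> exec i (mk p s) = mk (Suc p) (iex i s)"
  by (cases i) (simp_all add: mk_def iex_def)

lemma run_Suc: "run P s (Suc t) = run P (step P s) t"
  by (simp add: run_def funpow_swap1)

lemma run_add: "run P s (t + t') = run P (run P s t) t'"
  by (simp only: run_def add.commute[of t t'] funpow_add o_apply)

lemma run_0 [simp]: "run P s 0 = s"
  by (simp add: run_def)

lemma step_mk:
  assumes "p < length P" "P ! p \<noteq> Halt"
  shows "step P (mk p s) = exec (P ! p) (mk p s)"
  using assms by (simp add: step_def halted_def mk_def)

text \<open>Total correctness with a time bound. Quantifying over \<open>P\<close> and
  \<open>p\<close> makes it independent of the surrounding code. With the initial memory as last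
  argument, a judgement can serve as the postcondition of the preceding command.\<close>

definition runs :: "com \<Rightarrow> nat \<Rightarrow> (mem \<Rightarrow> bool) \<Rightarrow> mem \<Rightarrow> bool" where
  "runs c T Q s \<longleftrightarrow> (\<forall>P p. loaded P p (comp c p) \<longrightarrow>
     (\<exists>t s'. t \<le> T \<and> run P (mk p s) t = mk (p + clen c) s' \<and> Q s'))"

lemma runsD:
  assumes "runs c T Q s" "loaded P p (comp c p)"
  obtains t s' where "t \<le> T" "run P (mk p s) t = mk (p + clen c) s'" "Q s'"
  using assms unfolding runs_def by blast

lemma runs_mono:
  assumes "runs c T Q s" "T \<le> T'" "\<And>s'. Q s' \<Longrightarrow> Q' s'"
  shows "runs c T' Q' s"
  using assms unfolding runs_def by (meson order_trans)

lemma runs_Skip: "Q s \<Longrightarrow> runs Skip 0 Q s"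
  unfolding runs_def by (intro allI impI exI[of _ 0] exI[of _ s]) simp

lemma runs_Do:
  assumes "straight i" "Q (iex i s)"
  shows "runs (Do i) 1 Q s"
  unfolding runs_def
proof (intro allI impI)
  fix P p assume "loaded P p (comp (Do i) p)"
  then have "p < length P" "P ! p = i" using loaded_Cons[of P p i "[]"] by auto
  moreover have "i \<noteq> Halt" using assms(1) by auto
  ultimately have "run P (mk p s) 1 = mk (Suc p) (iex i s)"
    using assms(1) by (simp add: run_Suc step_mk exec_straight)
  then show "\<exists>t s'. t \<le> 1 \<and> run P (mk p s) t = mk (p + clen (Do i)) s' \<and> Q s'"
    using assms(2) by (intro exI[of _ 1] exI[of _ "iex i s"]) auto
qed

lemma runs_Seq:
  assumes "runs c1 T1 (\<lambda>s'. runs c2 T2 Q s') s"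
  shows "runs (c1 ;; c2) (T1 + T2) Q s"
  unfolding runs_def
proof (intro allI impI)
  fix P p assume "loaded P p (comp (c1 ;; c2) p)"
  then have l: "loaded P p (comp c1 p)" "loaded P (p + clen c1) (comp c2 (p + clen c1))"
    using loaded_append[of P p "comp c1 p" "comp c2 (p + clen c1)"] by auto
  obtain t1 s1 where 1: "t1 \<le> T1" "run P (mk p s) t1 = mk (p + clen c1) s1" "runs c2 T2 Q s1"
    using assms l(1) by (rule runsD)
  obtain t2 s2 where 2: "t2 \<le> T2" "run P (mk (p + clen c1) s1) t2 = mk (p + clen c1 + clen c2) s2" "Q s2"
    using 1(3) l(2) by (rule runsD)
  show "\<exists>t s'. t \<le> T1 + T2 \<and> run P (mk p s) t = mk (p + clen (c1 ;; c2)) s' \<and> Q s'"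
    using 1 2 by (intro exI[of _ "t1 + t2"] exI[of _ s2]) (auto simp: run_add add.assoc)
qed

text \<open>Both branches are charged, which avoids a maximum; the \<open>2\<close> pays for the
  test and for the jump over the other branch.\<close>

lemma runs_IfRLe:
  assumes "snd s a \<le> snd s b \<Longrightarrow> runs c1 T1 Q s" "\<not> snd s a \<le> snd s b \<Longrightarrow> runs c2 T2 Q s"
  shows "runs (IfRLe a b c1 c2) (T1 + T2 + 2) Q s"
  unfolding runs_def
proof (intro allI impI)
  fix P p assume l: "loaded P p (comp (IfRLe a b c1 c2) p)"
  let ?J = "JmpRLe a b (p + clen c2 + 2)"
  let ?K = "Jmp (p + clen c1 + clen c2 + 2)"
  have l0: "p < length P" "P ! p = ?J"
    and l1: "loaded P (Suc p) (comp c2 (Suc p) @ ?K # comp c1 (p + clen c2 + 2))"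
    using loaded_Cons[of P p ?J] l by auto
  have l2: "loaded P (Suc p) (comp c2 (Suc p))"
    and l3: "loaded P (Suc p + clen c2) (?K # comp c1 (p + clen c2 + 2))"
    using loaded_append[OF l1] by auto
  have l4: "Suc p + clen c2 < length P" "P ! (Suc p + clen c2) = ?K"
    "loaded P (p + clen c2 + 2) (comp c1 (p + clen c2 + 2))"
    using loaded_Cons[OF l3] by auto
  show "\<exists>t s'. t \<le> T1 + T2 + 2 \<and> run P (mk p s) t = mk (p + clen (IfRLe a b c1 c2)) s' \<and> Q s'"
  proof (cases "snd s a \<le> snd s b")
    case True
    obtain t s' where t: "t \<le> T1"
      "run P (mk (p + clen c2 + 2) s) t = mk (p + clen c2 + 2 + clen c1) s'" "Q s'"
      using assms(1)[OF True] l4(3) by (rule runsD)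
    have "step P (mk p s) = mk (p + clen c2 + 2) s"
      using l0 True by (simp add: step_mk) (simp add: mk_def)
    then show ?thesis
      using t by (intro exI[of _ "Suc t"] exI[of _ s']) (auto simp: run_Suc add_ac)
  next
    case False
    obtain t s' where t: "t \<le> T2" "run P (mk (Suc p) s) t = mk (Suc p + clen c2) s'" "Q s'"
      using assms(2)[OF False] l2 by (rule runsD)
    have 1: "step P (mk p s) = mk (Suc p) s"
      using l0 False by (simp add: step_mk) (simp add: mk_def)
    have 2: "step P (mk (Suc p + clen c2) s') = mk (p + clen c1 + clen c2 + 2) s'"
      using l4 by (simp add: step_mk) (simp add: mk_def)
    have "run P (mk p s) (Suc (t + 1)) = mk (p + clen c1 + clen c2 + 2) s'"
      using 1 2 t(2) by (simp only: run_Suc run_add One_nat_def run_0)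
    then show ?thesis
      using t by (intro exI[of _ "Suc (t + 1)"] exI[of _ s']) (auto simp: add_ac)
  qed
qed

text \<open>\<open>J\<close> is indexed by the number of completed iterations. Each iteration pays
  \<open>2\<close> for the test and the jump back, and the last \<open>1\<close> is the failing
  test.\<close>

lemma runs_While:
  assumes test: "\<And>j s. j \<le> N \<Longrightarrow> J j s \<Longrightarrow> fst s a < fst s b \<longleftrightarrow> j < N"
    and body: "\<And>j s. j < N \<Longrightarrow> J j s \<Longrightarrow> runs c T (J (Suc j)) s"
    and init: "J 0 s"
  shows "runs (While a b c) (N * (T + 2) + 1) (J N) s"
  unfolding runs_def
proof (intro allI impI)
  fix P p assume l: "loaded P p (comp (While a b c) p)"
  let ?J = "JmpILe b a (p + clen c + 2)"
  have l0: "p < length P" "P ! p = ?J" and l1: "loaded P (Suc p) (comp c (Suc p) @ [Jmp p])"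
    using loaded_Cons[of P p ?J] l by auto
  have l2: "loaded P (Suc p) (comp c (Suc p))" and l3: "loaded P (Suc p + clen c) [Jmp p]"
    using loaded_append[OF l1] by auto
  have l4: "Suc p + clen c < length P" "P ! (Suc p + clen c) = Jmp p"
    using loaded_Cons[OF l3] by auto
  have "\<exists>t s'. t \<le> j * (T + 2) \<and> run P (mk p s) t = mk p s' \<and> J j s'" if "j \<le> N" for j
    using that
  proof (induction j)
    case 0
    then show ?case using init by (intro exI[of _ 0] exI[of _ s]) auto
  next
    case (Suc j)
    then obtain t s1 where t: "t \<le> j * (T + 2)" "run P (mk p s) t = mk p s1" "J j s1" by auto
    obtain u s2 where u: "u \<le> T" "run P (mk (Suc p) s1) u = mk (Suc p + clen c) s2" "J (Suc j) s2"
      using body[OF _ t(3)] l2 Suc.prems by (auto elim: runsD)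
    have 1: "step P (mk p s1) = mk (Suc p) s1"
      using l0 test[OF _ t(3)] Suc.prems by (simp add: step_mk) (simp add: mk_def)
    have 2: "step P (mk (Suc p + clen c) s2) = mk p s2"
      using l4 by (simp add: step_mk) (simp add: mk_def)
    have "run P (mk p s) (t + Suc (u + 1)) = mk p s2"
      using 1 2 t(2) u(2) by (simp only: run_Suc run_add One_nat_def run_0)
    moreover have "t + Suc (u + 1) \<le> Suc j * (T + 2)" using t u by simp
    ultimately show ?case using u(3) by blast
  qed
  from this[of N] obtain t s' where t: "t \<le> N * (T + 2)" "run P (mk p s) t = mk p s'" "J N s'"
    by auto
  have "step P (mk p s') = mk (p + clen c + 2) s'"
    using l0 test[OF _ t(3)] by (simp add: step_mk) (simp add: mk_def)
  then have "run P (mk p s) (t + Suc 0) = mk (p + clen c + 2) s'"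
    using t(2) by (simp only: run_Suc run_add run_0)
  then show "\<exists>t s'. t \<le> N * (T + 2) + 1 \<and> run P (mk p s) t = mk (p + clen (While a b c)) s' \<and> J N s'"
    using t by (intro exI[of _ "t + Suc 0"] exI[of _ s']) auto
qed

section \<open>Loop-free code\<close>

fun loopfree :: "com \<Rightarrow> bool" where
  "loopfree Skip = True"
| "loopfree (Do i) = straight i"
| "loopfree (c1 ;; c2) = (loopfree c1 \<and> loopfree c2)"
| "loopfree (IfRLe a b c1 c2) = (loopfree c1 \<and> loopfree c2)"
| "loopfree (While a b c) = False"

text \<open>\<open>sem\<close> and the cost bound \<open>cst\<close> have junk values on loops.\<close>
fun sem :: "com \<Rightarrow> mem \<Rightarrow> mem" where
  "sem Skip s = s"
| "sem (Do i) s = iex i s"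
| "sem (c1 ;; c2) s = sem c2 (sem c1 s)"
| "sem (IfRLe a b c1 c2) s = (if snd s a \<le> snd s b then sem c1 s else sem c2 s)"
| "sem (While a b c) s = s"

fun cst :: "com \<Rightarrow> nat" where
  "cst Skip = 0"
| "cst (Do i) = 1"
| "cst (c1 ;; c2) = cst c1 + cst c2"
| "cst (IfRLe a b c1 c2) = cst c1 + cst c2 + 2"
| "cst (While a b c) = 0"

text \<open>Loop-free code is thus verified by rewriting with \<open>sem\<close>; only loops need
  invariants.\<close>

lemma runs_sem: "loopfree c \<Longrightarrow> Q (sem c s) \<Longrightarrow> runs c (cst c) Q s"
proof (induction c arbitrary: s Q)
  case (Seq c1 c2)
  have "runs c1 (cst c1) (\<lambda>s'. runs c2 (cst c2) Q s') s"
    using Seq.prems by (intro Seq.IH) auto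
  then show ?case by (simp add: runs_Seq)
next
  case (IfRLe a b c1 c2)
  have "runs (IfRLe a b c1 c2) (cst c1 + cst c2 + 2) Q s"
    using IfRLe.prems by (intro runs_IfRLe IfRLe.IH) auto
  then show ?case by simp
qed (simp_all add: runs_Skip runs_Do[simplified])

fun seqs :: "com list \<Rightarrow> com" where
  "seqs [] = Skip"
| "seqs (c # cs) = c ;; seqs cs"

lemma loopfree_seqs [simp]: "loopfree (seqs cs) \<longleftrightarrow> (\<forall>c\<in>set cs. loopfree c)"
  by (induction cs) auto

lemma sem_seqs_append [simp]: "sem (seqs (cs @ cs')) s = sem (seqs cs') (sem (seqs cs) s)"
  by (induction cs arbitrary: s) auto

text \<open>\<open>D\<close> collects the items already processed, so \<open>J\<close> can state
  what has been achieved for each of them.\<close>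

lemma runs_seqs_map:
  assumes "\<And>D x s. x \<in> set xs \<Longrightarrow> J D s \<Longrightarrow> runs (f x) T (J (insert x D)) s" "J D s"
  shows "runs (seqs (map f xs)) (length xs * T) (J (set xs \<union> D)) s"
  using assms
proof (induction xs arbitrary: D s)
  case Nil
  then show ?case by (auto intro: runs_Skip)
next
  case (Cons x xs)
  have "runs (f x) T (\<lambda>s'. runs (seqs (map f xs)) (length xs * T) (J (set xs \<union> insert x D)) s') s"
  proof (rule runs_mono[OF Cons.prems(1)])
    fix s' assume "J (insert x D) s'"
    then show "runs (seqs (map f xs)) (length xs * T) (J (set xs \<union> insert x D)) s'"
      using Cons.prems(1) by (intro Cons.IH) simp_all
  qed (use Cons.prems in simp_all)
  from runs_Seq[OF this] show ?case by simp
qed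

section \<open>Compilation of expressions\<close>

datatype bop = Plus | Minus | Times | Divide

fun app :: "bop \<Rightarrow> real \<Rightarrow> real \<Rightarrow> real" where
  "app Plus x y = x + y"
| "app Minus x y = x - y"
| "app Times x y = x * y"
| "app Divide x y = x / y"

fun bini :: "bop \<Rightarrow> nat \<Rightarrow> nat \<Rightarrow> nat \<Rightarrow> instr" where
  "bini Plus = RAdd"
| "bini Minus = RSub"
| "bini Times = RMul"
| "bini Divide = RDiv"

datatype rexp =
    Var nat
  | Cst int
  | Bin bop rexp rexp
  | IfLe rexp rexp rexp rexp

fun eval :: "rexp \<Rightarrow> (nat \<Rightarrow> real) \<Rightarrow> real" where
  "eval (Var x) R = R x"
| "eval (Cst k) R = of_int k"
| "eval (Bin f a b) R = app f (eval a R) (eval b R)"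
| "eval (IfLe a b e1 e2) R = (if eval a R \<le> eval b R then eval e1 R else eval e2 R)"

fun below :: "nat \<Rightarrow> rexp \<Rightarrow> bool" where
  "below t (Var x) = (x < t)"
| "below t (Cst k) = True"
| "below t (Bin f a b) = (below t a \<and> below t b)"
| "below t (IfLe a b e1 e2) = (below t a \<and> below t b \<and> below t e1 \<and> below t e2)"

fun depth :: "rexp \<Rightarrow> nat" where
  "depth (Var x) = 1"
| "depth (Cst k) = 1"
| "depth (Bin f a b) = Suc (max (depth a) (depth b))"
| "depth (IfLe a b e1 e2) = Suc (max (max (depth a) (depth b)) (max (depth e1) (depth e2)))"

text \<open>Register \<open>t\<close> is the top of a stack that grows upwards and receives the
  result. A variable is copied by adding it to zero, as there is no move instruction.\<close>

fun cexp :: "rexp \<Rightarrow> nat \<Rightarrow> com" where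
  "cexp (Var x) t = Do (RConst t 0) ;; Do (RAdd t t x)"
| "cexp (Cst k) t = Do (RConst t k)"
| "cexp (Bin f a b) t = cexp a t ;; cexp b (Suc t) ;; Do (bini f t t (Suc t))"
| "cexp (IfLe a b e1 e2) t = cexp a t ;; cexp b (Suc t) ;; IfRLe t (Suc t) (cexp e1 t) (cexp e2 t)"

definition agree :: "nat \<Rightarrow> nat \<Rightarrow> (nat \<Rightarrow> real) \<Rightarrow> (nat \<Rightarrow> real) \<Rightarrow> bool" where
  "agree t u R R' \<longleftrightarrow> (\<forall>r. r < t \<or> r \<ge> u \<longrightarrow> R' r = R r)"

lemma eval_cong: "below t e \<Longrightarrow> (\<And>r. r < t \<Longrightarrow> R r = R' r) \<Longrightarrow> eval e R = eval e R'"
  by (induction e) simp_all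

lemma straight_bini [simp]: "straight (bini f x y z)"
  by (cases f) auto

lemma loopfree_cexp [simp]: "loopfree (cexp e t)"
  by (induction e arbitrary: t) auto

lemma below_mono: "below t e \<Longrightarrow> t \<le> t' \<Longrightarrow> below t' e"
  by (induction e) auto

lemma depth_pos: "depth e > 0"
  by (cases e) auto

lemma sem_cexp:
  "below t e \<Longrightarrow> \<exists>R'. sem (cexp e t) (I, R) = (I, R') \<and> R' t = eval e R \<and> agree t (t + depth e) R R'"
proof (induction e arbitrary: t R)
  case (IfLe a b e1 e2)
  obtain R1 where 1: "sem (cexp a t) (I, R) = (I, R1)" "R1 t = eval a R" "agree t (t + depth a) R R1"
    using IfLe.IH(1)[of t R] IfLe.prems by auto
  obtain R2 where 2: "sem (cexp b (Suc t)) (I, R1) = (I, R2)" "R2 (Suc t) = eval b R1"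
    "agree (Suc t) (Suc t + depth b) R1 R2"
    using IfLe.IH(2)[of "Suc t" R1] IfLe.prems below_mono[of t b "Suc t"] by auto
  have e: "eval x R1 = eval x R" "eval x R2 = eval x R" if "below t x" for x
    using that 1 2 by (auto intro!: eval_cong simp: agree_def)
  have v: "R2 t = eval a R" "R2 (Suc t) = eval b R"
    using 1 2 e IfLe.prems by (auto simp: agree_def)
  have "agree t (t + depth (IfLe a b e1 e2)) R R'"
    if "agree t (t + depth x) R2 R'" "x = e1 \<or> x = e2" for R' x
    using that 1 2 by (auto simp: agree_def)
  then show ?case
    using IfLe.IH(3)[of t R2] IfLe.IH(4)[of t R2] IfLe.prems 1(1) 2(1) v e by (auto split: if_splits)
next
  case (Bin f a b)
  obtain R1 where 1: "sem (cexp a t) (I, R) = (I, R1)" "R1 t = eval a R" "agree t (t + depth a) R R1"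
    using Bin.IH(1)[of t R] Bin.prems by auto
  obtain R2 where 2: "sem (cexp b (Suc t)) (I, R1) = (I, R2)" "R2 (Suc t) = eval b R1"
    "agree (Suc t) (Suc t + depth b) R1 R2"
    using Bin.IH(2)[of "Suc t" R1] Bin.prems below_mono[of t b "Suc t"] by auto
  have "eval b R1 = eval b R"
    using Bin.prems 1 by (intro eval_cong[of t]) (auto simp: agree_def)
  then show ?case using 1 2 by (cases f) (auto simp: agree_def)
qed (auto simp: agree_def)

definition assign :: "nat \<Rightarrow> nat \<Rightarrow> rexp \<Rightarrow> com" where
  "assign t x e = cexp e t ;; Do (RConst x 0) ;; Do (RAdd x x t)"

lemma loopfree_assign [simp]: "loopfree (assign t x e)"
  by (simp add: assign_def)

lemma sem_assign:
  assumes "below t e" "x < t" "t + depth e \<le> u"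
  shows "\<exists>R'. sem (assign t x e) (I, R) = (I, R') \<and> agree t u (R(x := eval e R)) R'"
proof -
  obtain R' where "sem (cexp e t) (I, R) = (I, R')" "R' t = eval e R" "agree t (t + depth e) R R'"
    using sem_cexp[OF assms(1)] by blast
  then show ?thesis using assms by (auto simp: assign_def agree_def)
qed

text \<open>The assignments are simultaneous because none of them reads a register written by another.\<close>
lemma sem_assigns:
  assumes "distinct xs" "\<And>x. x \<in> set xs \<Longrightarrow> below t (E x) \<and> x < t \<and> t + depth (E x) \<le> u"
    and "\<And>x R y v. x \<in> set xs \<Longrightarrow> y \<in> set xs \<Longrightarrow> x \<noteq> y \<Longrightarrow> eval (E x) (R(y := v)) = eval (E x) R"
  shows "\<exists>R'. sem (seqs (map (\<lambda>x. assign t x (E x)) xs)) (I, R) = (I, R') \<and>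
     agree t u (\<lambda>r. if r \<in> set xs then eval (E r) R else R r) R'"
  using assms
proof (induction xs arbitrary: R)
  case Nil
  then show ?case by (simp add: agree_def)
next
  case (Cons x xs)
  obtain R1 where 1: "sem (assign t x (E x)) (I, R) = (I, R1)" "agree t u (R(x := eval (E x) R)) R1"
    using sem_assign[of t "E x" x u I R] Cons.prems(2) by auto
  obtain R2 where 2: "sem (seqs (map (\<lambda>x. assign t x (E x)) xs)) (I, R1) = (I, R2)"
    "agree t u (\<lambda>r. if r \<in> set xs then eval (E r) R1 else R1 r) R2"
    using Cons.IH[of R1] Cons.prems by auto
  have e: "eval (E r) R1 = eval (E r) R" if r: "r \<in> set xs" for r
  proof -
    have "eval (E r) R1 = eval (E r) (R(x := eval (E x) R))"
      using 1(2) Cons.prems(2) r by (intro eval_cong[of t]) (auto simp: agree_def)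
    also have "\<dots> = eval (E r) R" using r Cons.prems(1) by (intro Cons.prems(3)) auto
    finally show ?thesis .
  qed
  have "agree t u (\<lambda>r. if r \<in> set (x # xs) then eval (E r) R else R r) R2"
    using 1(2) 2(2) Cons.prems(1,2) e by (auto simp: agree_def)
  then show ?case using 1(1) 2(1) by simp
qed


section \<open>Labels as expressions\<close>

text \<open>Registers from \<open>j * d\<close> on hold the vector, block \<open>0\<close> being the
  point to be labelled. The conditions on \<open>q\<close> are settled when the expression is built,
  not at run time.\<close>

definition sepE :: "nat \<Rightarrow> nat \<Rightarrow> nat \<Rightarrow> nat \<Rightarrow> nat \<Rightarrow> rexp" where
  "sepE d a b j q = Bin Minus (if q < d * d \<and> q div d = a then Var (j * d + q mod d) else Cst 0)
     (if q < d * d \<and> q div d = b then Var (j * d + q mod d) else Cst 0)"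

definition elimE :: "(nat \<Rightarrow> rexp) \<Rightarrow> nat \<Rightarrow> (nat \<Rightarrow> rexp) \<Rightarrow> nat \<Rightarrow> rexp" where
  "elimE u p h = (\<lambda>q. Bin Minus (h q) (Bin Times (Bin Divide (h p) (u p)) (u q)))"

text \<open>Nonzeroness of \<open>x\<close> is tested by two comparisons. The copies of
  \<open>x\<close> make the expression exponential in the number of walls, which is still a constant
  for fixed \<open>d\<close>.\<close>

function lexE :: "nat \<Rightarrow> int \<Rightarrow> ((nat \<Rightarrow> rexp) \<times> nat) list \<Rightarrow> (nat \<Rightarrow> rexp) \<Rightarrow> rexp" where
  "lexE l s [] h = Bin Times (Cst s) (h l)"
| "lexE l s ((u, p) # us) h =
     (let x = lexE l s (map (\<lambda>(u', p'). (elimE u p u', p')) us) (elimE u p h)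
      in IfLe x (Cst 0) (IfLe (Cst 0) x (Bin Divide (h p) (u p)) x) x)"
  by pat_completeness auto
termination by (relation "measure (\<lambda>(l, s, us, h). length us)") auto

definition wallsE :: "nat \<Rightarrow> (nat \<times> nat \<times> nat) list \<Rightarrow> ((nat \<Rightarrow> rexp) \<times> nat) list" where
  "wallsE d cs = map (\<lambda>j. (sepE d (fst (cs ! j)) (fst (snd (cs ! j))) (Suc j), snd (snd (cs ! j))))
     [0..<length cs]"

text \<open>Truth values are encoded as reals: positive means true.\<close>

fun allposE :: "rexp list \<Rightarrow> rexp" where
  "allposE [] = Cst 1"
| "allposE (e # es) = IfLe e (Cst 0) (Cst 0) (allposE es)"

fun pickE :: "(nat \<Rightarrow> rexp) \<Rightarrow> nat \<Rightarrow> rexp" where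
  "pickE Q 0 = Cst 0"
| "pickE Q (Suc m) = IfLe (Q (Suc m)) (Cst 0) (pickE Q m) (Cst (int (Suc m)))"

fun labE :: "nat \<Rightarrow> config \<Rightarrow> rexp" where
  "labE d (cs, l, s) = pickE (\<lambda>a. allposE (map (\<lambda>b. lexE l s (wallsE d cs) (sepE d a b 0))
     (filter (\<lambda>b. b \<noteq> a) [0..<Suc d]))) d"

text \<open>This holds for zero pivots too, since the machine and \<open>lexval\<close> share the
  same total division.\<close>

lemma eval_lexE:
  "eval (lexE l s us h) R = lexval l (real_of_int s) (map (\<lambda>(u, p). (\<lambda>q. eval (u q) R, p)) us) (\<lambda>q. eval (h q) R)"
proof (induction l s us h rule: lexE.induct)
  case (2 l s u p us h)
  have e: "(\<lambda>q. eval (elimE u p h q) R) = elim (\<lambda>q. eval (u q) R) p (\<lambda>q. eval (h q) R)" for h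
    by (auto simp: elimE_def elim_def)
  have "map ((\<lambda>(u, p). (\<lambda>q. eval (u q) R, p)) \<circ> (\<lambda>(u', p'). (elimE u p u', p'))) us
     = map ((\<lambda>(u', p'). (elim (\<lambda>q. eval (u q) R) p u', p')) \<circ> (\<lambda>(u, p). (\<lambda>q. eval (u q) R, p))) us"
    by (auto simp: e)
  with 2 e show ?case by (auto simp: Let_def)
qed simp

lemma eval_allposE: "eval (allposE es) R > 0 \<longleftrightarrow> (\<forall>e\<in>set es. eval e R > 0)"
  by (induction es) auto

lemma eval_pickE: "eval (pickE Q m) R = real (pick (\<lambda>a. eval (Q a) R > 0) m)"
  by (induction m) auto

lemma sepvec_cong:
  assumes "d > 0" "\<And>k. k < d \<Longrightarrow> v k = v' k"
  shows "sepvec d a b v = sepvec d a b v'"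
  using assms by (auto simp: sepvec_def)

lemma eval_sepE: "eval (sepE d a b j q) R = sepvec d a b (\<lambda>k. R (j * d + k)) q"
  by (simp add: sepE_def sepvec_def)

lemma eval_labE:
  assumes d: "d > 0" and x: "\<And>k. k < d \<Longrightarrow> R k = V i k"
    and y: "\<And>j k. j < length cs \<Longrightarrow> k < d \<Longrightarrow> R (Suc j * d + k) = V (ix j) k"
  shows "eval (labE d (cs, l, s)) R = real (labelling d V (cs, l, s) ix i)"
proof -
  have w: "map (\<lambda>(u, p). (\<lambda>q. eval (u q) R, p)) (wallsE d cs) = walls d V cs ix"
  proof (rule nth_equalityI)
    fix j assume "j < length (map (\<lambda>(u, p). (\<lambda>q. eval (u q) R, p)) (wallsE d cs))"
    then have j: "j < length cs" by (simp add: wallsE_def)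
    have "sepvec d a b (\<lambda>k. R (Suc j * d + k)) = sepvec d a b (V (ix j))" for a b
      using y[OF j] by (intro sepvec_cong d)
    then show "map (\<lambda>(u, p). (\<lambda>q. eval (u q) R, p)) (wallsE d cs) ! j = walls d V cs ix ! j"
      using j by (simp add: wallsE_def walls_def eval_sepE)
  qed (simp add: wallsE_def walls_def)
  have "sepvec d a b (\<lambda>k. R (0 * d + k)) = sepvec d a b (V i)" for a b
    using x by (intro sepvec_cong d) simp
  then have "eval (lexE l s (wallsE d cs) (sepE d a b 0)) R
      = lexval l (real_of_int s) (walls d V cs ix) (sepvec d a b (V i))" for a b
    by (simp add: eval_lexE w eval_sepE)
  then have "eval (allposE (map (\<lambda>b. lexE l s (wallsE d cs) (sepE d a b 0))
       (filter (\<lambda>b. b \<noteq> a) [0..<Suc d]))) R > 0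
     \<longleftrightarrow> (\<forall>b\<le>d. b \<noteq> a \<longrightarrow> lexval l (real_of_int s) (walls d V cs ix) (sepvec d a b (V i)) > 0)" for a
    unfolding eval_allposE by (auto simp del: upt_Suc simp: less_Suc_eq_le)
  then show ?thesis by (simp only: labE.simps eval_pickE labelling.simps)
qed

lemma below_lexE:
  "(\<forall>(u, p)\<in>set us. \<forall>q. below t (u q)) \<Longrightarrow> (\<And>q. below t (h q)) \<Longrightarrow> below t (lexE l s us h)"
proof (induction l s us h rule: lexE.induct)
  case (2 l s u p us h)
  have "below t (lexE l s (map (\<lambda>(u', p'). (elimE u p u', p')) us) (elimE u p h))"
    using 2(2,3) by (intro 2(1)) (auto simp: elimE_def)
  then show ?case using 2(2,3) by (simp add: Let_def)
qed simp

lemma below_allposE: "(\<And>e. e \<in> set es \<Longrightarrow> below t e) \<Longrightarrow> below t (allposE es)"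
  by (induction es) auto

lemma below_pickE: "(\<And>a. below t (Q a)) \<Longrightarrow> below t (pickE Q m)"
  by (induction m) auto

lemma below_sepE:
  assumes "d > 0" "Suc j * d \<le> t"
  shows "below t (sepE d a b j q)"
proof -
  have "q mod d < d" using assms(1) by simp
  then have "j * d + q mod d < t" using assms(2) by simp
  then show ?thesis by (simp add: sepE_def)
qed

text \<open>The threshold counts \<open>d * d\<close> blocks of length \<open>d\<close>: one point
  and at most \<open>d * d - 1\<close> walls.\<close>

lemma below_labE:
  assumes d: "d > 0" and cs: "length cs < d * d" and t: "d * d * d \<le> t"
  shows "below t (labE d (cs, l, s))"
proof -
  have b: "below t (sepE d a b j q)" if "j \<le> length cs" for a b j q
  proof (rule below_sepE[OF d])
    have "Suc j * d \<le> d * d * d" using that cs by (intro mult_right_mono) auto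
    then show "Suc j * d \<le> t" using t by simp
  qed
  have "\<forall>(u, p)\<in>set (wallsE d cs). \<forall>q. below t (u q)"
    by (auto simp: wallsE_def intro!: b)
  then show ?thesis
    unfolding labE.simps
    by (intro below_pickE below_allposE) (auto intro!: below_lexE b)
qed

section \<open>The program\<close>

text \<open>Integer registers: 0 and 3 point to the best and to the current array of labels, 1 contains
  the number 1, 2 the address of the copy of the input, 4 the number of points, 6 and 8, 9, \<dots> the loop
  counters; 5 and 7 are scratch. Real registers: blocks of length \<open>d\<close> for the point being
  labelled and the points defining the walls, then the cluster sums, the label of the current point,
  the score of the current labelling, the best score, and the stack used for evaluating expressions, which ends before \<open>B\<close>.\<close>

definition sbase :: "nat \<Rightarrow> nat" where "sbase d = d * d * d"
definition lreg :: "nat \<Rightarrow> nat" where "lreg d = sbase d + Suc d * d"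
definition screg :: "nat \<Rightarrow> nat" where "screg d = lreg d + 1"
definition breg :: "nat \<Rightarrow> nat" where "breg d = lreg d + 2"
definition tmp :: "nat \<Rightarrow> nat" where "tmp d = lreg d + 3"
text \<open>Bounds the integer registers with a fixed role: eight, and the loop counters
  \<open>8 + j\<close> with \<open>j < d * d - 1\<close>. The label arrays lie above it.\<close>

definition kint :: "nat \<Rightarrow> nat" where "kint d = 8 + d * d"

text \<open>The offset of a point is its index times \<open>d\<close>, obtained by adding the index
  \<open>d\<close> times.\<close>

definition load :: "nat \<Rightarrow> nat \<Rightarrow> nat \<Rightarrow> com" where
  "load d j r = Do (IConst 5 0) ;; Do (IAdd 5 5 2) ;; seqs (replicate d (Do (IAdd 5 5 r))) ;;
     seqs (map (\<lambda>k. Do (RLoad (j * d + k) 5) ;; Do (IAdd 5 5 1)) [0..<d])"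

definition accE :: "nat \<Rightarrow> nat \<Rightarrow> rexp" where
  "accE d r = Bin Plus (Var r) (let a = Cst (int ((r - sbase d) div d)) in
     IfLe (Var (lreg d)) a (IfLe a (Var (lreg d)) (Var ((r - sbase d) mod d)) (Cst 0)) (Cst 0))"

fun scoreE :: "nat \<Rightarrow> nat \<Rightarrow> rexp" where
  "scoreE d 0 = Cst 0"
| "scoreE d (Suc q) = Bin Plus (scoreE d q) (Bin Times (Var (sbase d + q)) (Var (sbase d + q)))"

text \<open>Replaces the missing conversion from reals to integers: equality with each possible
  label is tested by two comparisons.\<close>

definition setlab :: "nat \<Rightarrow> nat list \<Rightarrow> com" where
  "setlab d as = seqs (map (\<lambda>a. Do (RConst (screg d) (int a)) ;;
     IfRLe (lreg d) (screg d) (IfRLe (screg d) (lreg d) (Do (IConst 7 (int a))) Skip) Skip) as)"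

definition point :: "nat \<Rightarrow> config \<Rightarrow> com" where
  "point d \<theta> = load d 0 6 ;; assign (tmp d) (lreg d) (labE d \<theta>) ;;
     seqs (map (\<lambda>r. assign (tmp d) r (accE d r)) [sbase d..<lreg d]) ;; setlab d [0..<Suc d] ;;
     Do (IAdd 5 3 6) ;; Do (IStore 5 7) ;; Do (IAdd 6 6 1)"

definition prelude :: "nat \<Rightarrow> com" where
  "prelude d = seqs (map (\<lambda>r. assign (tmp d) r (Cst 0)) [sbase d..<lreg d]) ;; Do (IConst 6 0)"

text \<open>A better labelling is kept by exchanging the two array pointers through their sum,
  without copying labels.\<close>

definition update :: "nat \<Rightarrow> com" where
  "update d = assign (tmp d) (screg d) (scoreE d (Suc d * d)) ;;
     IfRLe (screg d) (breg d) Skip (assign (tmp d) (breg d) (Var (screg d)) ;;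
       Do (IAdd 7 0 3) ;; Do (ISub 0 7 0) ;; Do (ISub 3 7 3))"

definition body :: "nat \<Rightarrow> config \<Rightarrow> com" where
  "body d \<theta> = prelude d ;; While 6 4 (point d \<theta>) ;; update d"

text \<open>Counter \<open>8 + j\<close> runs over the choices of \<open>ix j\<close>. With
  \<open>d * d - 1\<close> levels and the point loop inside \<open>body\<close>, this gives the
  exponent.\<close>

fun nest :: "nat \<Rightarrow> config \<Rightarrow> nat \<Rightarrow> com" where
  "nest d \<theta> 0 = body d \<theta>"
| "nest d \<theta> (Suc j) = Do (IConst (8 + j) 0) ;;
     While (8 + j) 4 (load d (Suc j) (8 + j) ;; nest d \<theta> j ;; Do (IAdd (8 + j) (8 + j) 1))"

text \<open>The first \<open>B\<close> real registers become working space, so their contents are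
  saved by straight-line code; after that register \<open>0\<close> is free to serve as transit for
  copying the rest in a loop.\<close>

definition prep_copy :: "nat \<Rightarrow> nat \<Rightarrow> com" where
  "prep_copy d B = Do (IConst 1 1) ;; Do (IConst 7 0) ;; seqs (replicate d (Do (IAdd 7 7 0))) ;;
     Do (IConst 2 (int B)) ;; Do (IAdd 2 2 7) ;; Do (IConst 4 0) ;; Do (IAdd 4 4 0) ;;
     Do (IConst 3 (int (kint d))) ;; Do (IAdd 3 3 4) ;; Do (IAdd 0 3 4) ;;
     Do (IConst 5 0) ;; Do (IAdd 5 5 2) ;;
     seqs (map (\<lambda>r. Do (RStore 5 r) ;; Do (IAdd 5 5 1)) [0..<B]) ;; Do (IConst 6 (int B))"

definition copy_step :: com where
  "copy_step = Do (RLoad 0 6) ;; Do (RStore 5 0) ;; Do (IAdd 5 5 1) ;; Do (IAdd 6 6 1)"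

definition prepare :: "nat \<Rightarrow> nat \<Rightarrow> com" where
  "prepare d B = prep_copy d B ;; While 6 7 copy_step ;; Do (RConst (breg d) (-1))"

definition emit_step :: com where
  "emit_step = Do (IAdd 5 0 6) ;; Do (ILoad 7 5) ;; Do (IStore 6 7) ;; Do (IAdd 6 6 1)"

text \<open>The labels finally overwrite the program's own variables. Each register computes its
  source address in itself, and the array pointer in register \<open>0\<close> is replaced
  last.\<close>

definition emit_fixed :: "nat \<Rightarrow> com" where
  "emit_fixed d = seqs (map (\<lambda>r. Do (IConst r (int r)) ;; Do (IAdd r r 0) ;; Do (ILoad r r)) [1..<kint d]) ;;
     Do (ILoad 0 0)"

definition emit :: "nat \<Rightarrow> com" where
  "emit d = Do (IConst 6 (int (kint d))) ;; While 6 4 emit_step ;; emit_fixed d"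

definition main :: "nat \<Rightarrow> nat \<Rightarrow> com" where
  "main d B = prepare d B ;; seqs (map (\<lambda>\<theta>. nest d \<theta> (d * d - 1)) (configs d)) ;; emit d"

lemma sem_add_repeat:
  "x \<noteq> r \<Longrightarrow> sem (seqs (replicate m (Do (IAdd x x r)))) (I, R) = (I(x := I x + int m * I r), R)"
  by (induction m arbitrary: I) (auto simp: algebra_simps)

lemma loopfree_load [simp]: "loopfree (load d j r)"
  by (auto simp: load_def)

lemma loopfree_setlab [simp]: "loopfree (setlab d as)"
  by (auto simp: setlab_def)

lemma loopfree_point: "loopfree (point d \<theta>)"
  by (auto simp: point_def)

lemma loopfree_prelude: "loopfree (prelude d)"
  by (auto simp: prelude_def)

lemma loopfree_update: "loopfree (update d)"
  by (auto simp: update_def)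

lemma loopfree_prep_copy: "loopfree (prep_copy d B)"
  by (auto simp: prep_copy_def)

lemma loopfree_emit_fixed: "loopfree (emit_fixed d)"
  by (auto simp: emit_fixed_def)

lemma below_accE:
  assumes "d > 0" "sbase d \<le> r" "r < lreg d"
  shows "below (tmp d) (accE d r)"
proof -
  have "(r - sbase d) mod d < d" using assms by simp
  moreover have "d \<le> lreg d" by (simp add: lreg_def)
  ultimately have "(r - sbase d) mod d < lreg d + 3" by linarith
  then show ?thesis using assms by (simp add: accE_def tmp_def Let_def)
qed

lemma eval_accE:
  assumes "R (lreg d) = real m"
  shows "eval (accE d r) R = R r + (if m = (r - sbase d) div d then R ((r - sbase d) mod d) else 0)"
  using assms by (auto simp: accE_def Let_def)

lemma below_scoreE: "q \<le> Suc d * d \<Longrightarrow> below (tmp d) (scoreE d q)"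
  by (induction q) (auto simp: tmp_def lreg_def)

lemma eval_scoreE: "eval (scoreE d q) R = (\<Sum>p<q. (R (sbase d + p))\<^sup>2)"
  by (induction q) (auto simp: power2_eq_square)

lemma sem_setlab:
  assumes "R (lreg d) = real m"
  shows "\<exists>x. sem (setlab d as) (I, R) = (I(7 := if m \<in> set as then int m else I 7), R(screg d := x))"
  using assms
proof (induction as arbitrary: I R)
  case Nil
  show ?case by (intro exI[of _ "R (screg d)"]) (simp add: setlab_def)
next
  case (Cons a as)
  let ?I = "I(7 := if m = a then int m else I 7)"
  let ?R = "R(screg d := real a)"
  have "?R (lreg d) = real m" using Cons.prems by (simp add: screg_def)
  from Cons.IH[where R = ?R and I = ?I, OF this] obtain x where
    x: "sem (setlab d as) (?I, ?R) = (?I(7 := if m \<in> set as then int m else ?I 7), ?R(screg d := x))"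
    by blast
  have "sem (setlab d (a # as)) (I, R) = sem (setlab d as) (?I, ?R)"
    using Cons.prems by (auto simp: setlab_def screg_def)
  also have "\<dots> = (I(7 := if m \<in> set (a # as) then int m else I 7), R(screg d := x))"
    unfolding x by auto
  finally show ?case by blast
qed

definition bcost :: "nat \<Rightarrow> config \<Rightarrow> nat" where
  "bcost d \<theta> = cst (prelude d) + cst (point d \<theta>) + cst (update d) + 3"

fun ncost :: "nat \<Rightarrow> config \<Rightarrow> nat \<Rightarrow> nat" where
  "ncost d \<theta> 0 = bcost d \<theta>"
| "ncost d \<theta> (Suc j) = ncost d \<theta> j + cst (load d (Suc j) (8 + j)) + 5"

section \<open>Invariants and running time for a fixed instance\<close>

locale instance_data =
  fixes d B n :: nat and V :: "nat \<Rightarrow> nat \<Rightarrow> real"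
  assumes d: "d \<ge> 1" and n: "n \<ge> 1"
    and B_lab: "\<And>\<theta>. \<theta> \<in> set (configs d) \<Longrightarrow> tmp d + depth (labE d \<theta>) \<le> B"
    and B_score: "tmp d + depth (scoreE d (Suc d * d)) \<le> B"
    and B_acc: "\<And>r. tmp d + depth (accE d r) \<le> B"
begin

definition base :: nat where "base = B + n * d"

definition has_input :: "(nat \<Rightarrow> real) \<Rightarrow> bool" where
  "has_input R \<longleftrightarrow> (\<forall>i<n. \<forall>k<d. R (base + i * d + k) = V i k)"

definition val :: "(nat \<Rightarrow> nat) \<Rightarrow> real" where
  "val f = same_sum n (gram d V) f"

text \<open>The gap of \<open>n\<close> registers keeps the output, written to registers below
  \<open>n\<close>, from overwriting the arrays.\<close>

definition arr :: nat where "arr = kint d + n"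

text \<open>The best score starts at \<open>-1\<close>, which no labelling attains because scores
  are sums of squares; any other value is witnessed by the array at pointer
  \<open>0\<close>.\<close>

definition inv :: "mem \<Rightarrow> bool" where
  "inv s \<longleftrightarrow> (case s of (I, R) \<Rightarrow> I 1 = 1 \<and> I 2 = int base \<and> I 4 = int n
     \<and> (I 0 = int arr \<and> I 3 = int (arr + n) \<or> I 0 = int (arr + n) \<and> I 3 = int arr)
     \<and> has_input R
     \<and> (R (breg d) = -1 \<or> (\<exists>f. (\<forall>i<n. I (nat (I 0) + i) = int (f i)) \<and> R (breg d) = val f)))"

lemma le_mult_n: "x \<le> x * n"
  using mult_le_mono2[OF n, of x] by simp

lemma B_tmp: "tmp d < B" "tmp d + 1 \<le> B"
  using B_score depth_pos[of "scoreE d (Suc d * d)"] by auto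

lemma sem_load:
  assumes I: "I 1 = 1" "I 2 = int base" "I r = int i" and "r \<noteq> 5" "i < n" "Suc j * d \<le> B"
    and R: "has_input R"
  shows "\<exists>x. sem (load d j r) (I, R) = (I(5 := x), \<lambda>q. if j * d \<le> q \<and> q < j * d + d then V i (q - j * d) else R q)"
proof -
  define b where "b = base + i * d"
  have copy: "sem (seqs (map (\<lambda>k. Do (RLoad (j * d + k) 5) ;; Do (IAdd 5 5 1)) [0..<m])) (I(5 := int b), R)
     = (I(5 := int (b + m)), \<lambda>q. if j * d \<le> q \<and> q < j * d + m then V i (q - j * d) else R q)"
    if "m \<le> d" for m
    using that
  proof (induction m)
    case 0
    show ?case by auto
  next
    case (Suc m)
    \<comment> \<open>The targets lie below \<open>B\<close> and the copied input above, so nothing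
      is overwritten before it is read.\<close>
    have "j * d + m < B" using Suc.prems assms(6) by simp
    then have "\<not> b + m < j * d + m" by (simp add: b_def base_def)
    moreover have "R (b + m) = V i m"
      using R Suc.prems \<open>i < n\<close> by (simp add: has_input_def b_def)
    moreover have "nat (int b + int m) = b + m" by simp
    ultimately show ?case
      using Suc I(1) by (auto simp: fun_eq_iff less_Suc_eq)
  qed
  have "sem (load d j r) (I, R)
     = sem (seqs (map (\<lambda>k. Do (RLoad (j * d + k) 5) ;; Do (IAdd 5 5 1)) [0..<d])) (I(5 := int b), R)"
    using I \<open>r \<noteq> 5\<close> by (simp add: load_def sem_add_repeat mult.commute b_def)
  then show ?thesis using copy[of d] by auto
qed

lemma inv_cong:
  assumes "inv (I, R)" "\<And>r. r < 5 \<Longrightarrow> I' r = I r" "\<And>i. i < n \<Longrightarrow> I' (nat (I 0) + i) = I (nat (I 0) + i)"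
    "R' (breg d) = R (breg d)" "\<And>r. r \<ge> B \<Longrightarrow> R' r = R r"
  shows "inv (I', R')"
proof -
  have "has_input R' = has_input R" using assms(5) by (simp add: has_input_def base_def)
  then show ?thesis using assms(1-4) by (auto simp: inv_def)
qed

lemma kint_arr: "kint d \<le> arr" "8 \<le> kint d" "arr + n = kint d + n + n"
  by (auto simp: arr_def kint_def)

text \<open>The invariant of the point loop, relative to the memory \<open>s\<close> before it.
  Block \<open>0\<close> and the scratch registers are left unconstrained, while the wall blocks and
  the best array must survive.\<close>

definition lab_state :: "config \<Rightarrow> (nat \<Rightarrow> nat) \<Rightarrow> mem \<Rightarrow> nat \<Rightarrow> mem \<Rightarrow> bool" where
  "lab_state \<theta> ix s m s' \<longleftrightarrow> (case s of (I, R) \<Rightarrow> case s' of (I', R') \<Rightarrow>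
     I' 6 = int m
     \<and> (\<forall>r. r \<notin> {5, 6, 7} \<and> (r < nat (I 3) \<or> nat (I 3) + n \<le> r) \<longrightarrow> I' r = I r)
     \<and> (\<forall>i<m. I' (nat (I 3) + i) = int (labelling d V \<theta> ix i))
     \<and> (\<forall>r. d \<le> r \<and> r < sbase d \<or> r = breg d \<or> B \<le> r \<longrightarrow> R' r = R r)
     \<and> (\<forall>q<Suc d * d. R' (sbase d + q) =
          (\<Sum>i<m. if labelling d V \<theta> ix i = q div d then V i (q mod d) else 0)))"

lemma sem_prelude:
  assumes "inv (I, R)"
  shows "lab_state \<theta> ix (I, R) 0 (sem (prelude d) (I, R))"
proof -
  have "\<exists>R'. sem (seqs (map (\<lambda>x. assign (tmp d) x (Cst 0)) [sbase d..<lreg d])) (I, R) = (I, R') \<and>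
     agree (tmp d) B (\<lambda>r. if r \<in> set [sbase d..<lreg d] then eval (Cst 0) R else R r) R'"
    using B_tmp by (intro sem_assigns) (auto simp: tmp_def)
  then show ?thesis using B_tmp
    by (auto simp: prelude_def lab_state_def agree_def lreg_def breg_def tmp_def)
qed

lemma sem_point:
  assumes \<theta>: "\<theta> \<in> set (configs d)" and inv: "inv (I, R)"
    and y: "\<And>j k. j < d * d - 1 \<Longrightarrow> k < d \<Longrightarrow> R (Suc j * d + k) = V (ix j) k"
    and m: "m < n" and s: "lab_state \<theta> ix (I, R) m (I1, R1)"
  shows "lab_state \<theta> ix (I, R) (Suc m) (sem (point d \<theta>) (I1, R1))"
proof -
  let ?L = "labelling d V \<theta> ix"
  define c where "c = nat (I 3)"
  have c: "I 3 = int c" "kint d \<le> c" using inv kint_arr by (auto simp: inv_def c_def)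
  have c8: "8 \<le> c" using c kint_arr by simp
  obtain cs l sg where \<theta>eq: "\<theta> = (cs, l, sg)" by (cases \<theta>) auto
  have lcs: "length cs = d * d - 1" using \<theta> by (auto simp: \<theta>eq configs_def set_n_lists)
  have dd: "d \<le> sbase d" "0 < d * d" using d by (auto simp: sbase_def)
  have I1: "I1 1 = 1" "I1 2 = int base" "I1 3 = int c" "I1 6 = int m"
    using s inv c c8 by (auto simp: lab_state_def inv_def)
  have I1f: "I1 r = I r" if "r \<notin> {5, 6, 7}" "r < c \<or> c + n \<le> r" for r
    using s that by (simp add: lab_state_def c_def)
  have I1l: "I1 (c + i) = int (?L i)" if "i < m" for i
    using s that by (simp add: lab_state_def c_def)
  have R1f: "R1 r = R r" if "d \<le> r \<and> r < sbase d \<or> r = breg d \<or> B \<le> r" for r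
    using s that by (auto simp: lab_state_def)
  have R1s: "R1 (sbase d + q) = (\<Sum>i<m. if ?L i = q div d then V i (q mod d) else 0)" if "q < Suc d * d" for q
    using s that by (simp add: lab_state_def)
  have "has_input R1" using inv R1f by (auto simp: has_input_def inv_def base_def)
  moreover have "Suc 0 * d \<le> B" using dd B_tmp by (simp add: tmp_def lreg_def)
  ultimately obtain x where x: "sem (load d 0 6) (I1, R1)
      = (I1(5 := x), \<lambda>q. if 0 * d \<le> q \<and> q < 0 * d + d then V m (q - 0 * d) else R1 q)"
    using sem_load[of I1 6 m 0 R1] I1 m by auto
  define I2 where "I2 = I1(5 := x)"
  define R2 where "R2 = (\<lambda>q. if q < d then V m q else R1 q)"
  have 2: "sem (load d 0 6) (I1, R1) = (I2, R2)"
    unfolding x I2_def R2_def by (simp add: fun_eq_iff)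
  have ev: "eval (labE d \<theta>) R2 = real (?L m)"
    unfolding \<theta>eq
  proof (rule eval_labE)
    show "d > 0" using d by simp
    show "R2 k = V m k" if "k < d" for k using that by (simp add: R2_def)
    show "R2 (Suc j * d + k) = V (ix j) k" if j: "j < length cs" "k < d" for j k
    proof -
      have "Suc (Suc j) * d \<le> d * d * d" using j lcs dd by (intro mult_right_mono) auto
      then have "Suc j * d + k < sbase d" using j(2) by (simp add: sbase_def)
      then show ?thesis using R1f[of "Suc j * d + k"] y j lcs by (simp add: R2_def)
    qed
  qed
  have bl: "below (tmp d) (labE d \<theta>)"
    unfolding \<theta>eq using d lcs dd by (intro below_labE) (auto simp: tmp_def lreg_def sbase_def)
  obtain R3 where 3: "sem (assign (tmp d) (lreg d) (labE d \<theta>)) (I2, R2) = (I2, R3)"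
    "agree (tmp d) B (R2(lreg d := real (?L m))) R3"
    using sem_assign[OF bl, of "lreg d" B I2 R2] B_lab[OF \<theta>] ev by (auto simp: tmp_def)
  have "\<exists>R'. sem (seqs (map (\<lambda>x. assign (tmp d) x (accE d x)) [sbase d..<lreg d])) (I2, R3) = (I2, R') \<and>
     agree (tmp d) B (\<lambda>r. if r \<in> set [sbase d..<lreg d] then eval (accE d r) R3 else R3 r) R'"
  proof (rule sem_assigns)
    fix x y v and R :: "nat \<Rightarrow> real" assume xy: "x \<in> set [sbase d..<lreg d]" "y \<in> set [sbase d..<lreg d]" "x \<noteq> y"
    \<comment> \<open>Besides its own register and the label, \<open>accE\<close> reads only block
      \<open>0\<close>, which lies below all cluster sums.\<close>
    have "(x - sbase d) mod d < d" using d by simp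
    then have "(x - sbase d) mod d \<noteq> y" using xy dd by auto
    then show "eval (accE d x) (R(y := v)) = eval (accE d x) R"
      using xy by (simp add: accE_def Let_def)
  qed (use d B_acc below_accE in \<open>auto simp: tmp_def\<close>)
  then obtain R4 where 4: "sem (seqs (map (\<lambda>x. assign (tmp d) x (accE d x)) [sbase d..<lreg d])) (I2, R3) = (I2, R4)"
     "agree (tmp d) B (\<lambda>r. if r \<in> set [sbase d..<lreg d] then eval (accE d r) R3 else R3 r) R4"
    by blast
  have R3l: "R3 (lreg d) = real (?L m)" using 3(2) by (simp add: agree_def tmp_def)
  have R4l: "R4 (lreg d) = real (?L m)" using 4(2) R3l by (simp add: agree_def tmp_def)
  obtain z where z: "sem (setlab d [0..<Suc d]) (I2, R4)
      = (I2(7 := if ?L m \<in> set [0..<Suc d] then int (?L m) else I2 7), R4(screg d := z))"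
    using sem_setlab[of R4 d "?L m", OF R4l] by blast
  have Lm: "?L m \<in> set [0..<Suc d]" using labelling_le[of d V \<theta> ix m] by auto
  define I3 where "I3 = I2(7 := int (?L m))"
  have 5: "sem (setlab d [0..<Suc d]) (I2, R4) = (I3, R4(screg d := z))"
    using z Lm by (simp add: I3_def)
  define I5 where "I5 = I3(5 := int (c + m), c + m := int (?L m), 6 := int (Suc m))"
  have "c + m \<noteq> 6" "c + m \<noteq> 1" "c + m \<noteq> 5" "c + m \<noteq> 7" using c8 by auto
  then have sem: "sem (point d \<theta>) (I1, R1) = (I5, R4(screg d := z))"
    using I1 unfolding point_def I5_def
    by (simp add: 2 3(1) 4(1) 5 del: upt_Suc) (simp add: I3_def I2_def nat_add_distrib fun_eq_iff)
  have "I5 6 = int (Suc m)" by (simp add: I5_def)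
  moreover have "I5 r = I r" if "r \<notin> {5, 6, 7}" "r < c \<or> c + n \<le> r" for r
    using that I1f[OF that] m by (auto simp: I5_def I3_def I2_def)
  moreover have "I5 (c + i) = int (?L i)" if "i < Suc m" for i
    using that I1l[of i] c8 by (auto simp: I5_def I3_def I2_def less_Suc_eq)
  moreover have "(R4(screg d := z)) r = R r" if r: "d \<le> r \<and> r < sbase d \<or> r = breg d \<or> B \<le> r" for r
  proof -
    have "r < tmp d \<or> r \<ge> B" "r \<notin> set [sbase d..<lreg d]" "r \<noteq> lreg d" "r \<noteq> screg d" "\<not> r < d"
      using r B_tmp dd by (auto simp: tmp_def breg_def screg_def lreg_def)
    then show ?thesis
      using R1f[OF r] 3(2) 4(2) by (auto simp: agree_def R2_def)
  qed
  moreover have "(R4(screg d := z)) (sbase d + q)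
      = (\<Sum>i<Suc m. if ?L i = q div d then V i (q mod d) else 0)" if q: "q < Suc d * d" for q
  proof -
    have r: "sbase d + q \<in> set [sbase d..<lreg d]" "sbase d + q < tmp d" "sbase d + q \<noteq> screg d"
      "sbase d + q \<noteq> lreg d" "\<not> sbase d + q < d"
      using q dd by (auto simp: tmp_def screg_def lreg_def)
    have qm: "q mod d < d" using d by simp
    then have "q mod d < tmp d" "q mod d \<noteq> lreg d" using dd by (auto simp: tmp_def lreg_def)
    then have "R3 (q mod d) = V m (q mod d)" using 3(2) qm by (simp add: agree_def R2_def)
    moreover have "R3 (sbase d + q) = R1 (sbase d + q)"
      using 3(2) r by (simp add: agree_def R2_def)
    moreover have "R4 (sbase d + q) = eval (accE d (sbase d + q)) R3"
      using 4(2) r by (simp add: agree_def)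
    ultimately show ?thesis
      using r R1s[OF q] by (simp add: eval_accE[of R3 d "?L m", OF R3l])
  qed
  ultimately show ?thesis
    unfolding sem lab_state_def c_def[symmetric] prod.case by blast
qed

lemma val_eq: "(\<And>i. f i \<le> d) \<Longrightarrow> val f = (\<Sum>q<Suc d * d. (csum n V f (q div d) (q mod d))\<^sup>2)"
proof -
  assume f: "\<And>i. f i \<le> d"
  have "val f = (\<Sum>a<Suc d. \<Sum>k<d. (csum n V f a k)\<^sup>2)"
    unfolding val_def using f by (intro same_sum_gram) (auto simp: less_Suc_eq_le)
  then show ?thesis using sum_divmod[where g = "\<lambda>a k. (csum n V f a k)\<^sup>2" and m = "Suc d" and d = d]
    by (simp only:)
qed

text \<open>What the enclosing loops need from level \<open>j\<close>: their counters and the blocks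
  of walls \<open>j\<close> and above are intact, and the best score has not decreased.\<close>

definition frame :: "nat \<Rightarrow> mem \<Rightarrow> mem \<Rightarrow> bool" where
  "frame j s s' \<longleftrightarrow> (\<forall>r. 8 + j \<le> r \<and> r < kint d \<longrightarrow> fst s' r = fst s r)
     \<and> (\<forall>r. Suc j * d \<le> r \<and> r < sbase d \<longrightarrow> snd s' r = snd s r)
     \<and> snd s (breg d) \<le> snd s' (breg d)"

lemma sem_update:
  assumes inv: "inv (I, R)" and s: "lab_state \<theta> ix (I, R) n (I1, R1)"
  shows "inv (sem (update d) (I1, R1)) \<and> frame 0 (I, R) (sem (update d) (I1, R1)) \<and>
    val (labelling d V \<theta> ix) \<le> snd (sem (update d) (I1, R1)) (breg d)"
proof -
  let ?L = "labelling d V \<theta> ix"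
  define c where "c = nat (I 3)"
  have c: "I 3 = int c" "kint d \<le> c" using inv kint_arr by (auto simp: inv_def c_def)
  have c8: "8 \<le> c" using c kint_arr by simp
  have I1f: "I1 r = I r" if "r \<notin> {5, 6, 7}" "r < c \<or> c + n \<le> r" for r
    using s that by (simp add: lab_state_def c_def)
  have I1l: "I1 (c + i) = int (?L i)" if "i < n" for i
    using s that by (simp add: lab_state_def c_def)
  have R1f: "R1 r = R r" if "d \<le> r \<and> r < sbase d \<or> r = breg d \<or> B \<le> r" for r
    using s that by (auto simp: lab_state_def)
  have R1s: "R1 (sbase d + q) = csum n V ?L (q div d) (q mod d)" if "q < Suc d * d" for q
    using s that by (simp add: lab_state_def csum_def)
  have "eval (scoreE d (Suc d * d)) R1 = val ?L"
    unfolding eval_scoreE by (subst val_eq) (auto simp: labelling_le R1s)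
  then obtain R2 where 2: "sem (assign (tmp d) (screg d) (scoreE d (Suc d * d))) (I1, R1) = (I1, R2)"
    "agree (tmp d) B (R1(screg d := val ?L)) R2"
    using sem_assign[OF below_scoreE, of "Suc d * d" d "screg d" B I1 R1] B_score
    by (auto simp: tmp_def screg_def)
  have R2s: "R2 (screg d) = val ?L" "R2 (breg d) = R (breg d)"
    using 2(2) R1f[of "breg d"] by (auto simp: agree_def tmp_def screg_def breg_def)
  have R2f: "R2 r = R r" if "d \<le> r \<and> r < sbase d \<or> B \<le> r" for r
  proof -
    have "r < tmp d \<or> B \<le> r" "r \<noteq> screg d"
      using that B_tmp by (auto simp: tmp_def screg_def lreg_def)
    then show ?thesis using R1f[of r] that 2(2) by (auto simp: agree_def)
  qed
  have I1k: "I1 r = I r" if "r < 5 \<or> 8 \<le> r \<and> r < kint d" for r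
    using that c c8 by (intro I1f) auto
  have best: "nat (I 0) + i < c \<or> c + n \<le> nat (I 0) + i" "8 \<le> nat (I 0) + i" if "i < n" for i
    using inv that kint_arr unfolding inv_def c_def by auto
  have inv1: "inv (I1, R2)"
    using inv
  proof (rule inv_cong)
    show "I1 (nat (I 0) + i) = I (nat (I 0) + i)" if "i < n" for i
      using best[OF that] by (intro I1f) auto
  qed (use I1k R2s R2f in auto)
  show ?thesis
  proof (cases "val ?L \<le> R (breg d)")
    case True
    then have "sem (update d) (I1, R1) = (I1, R2)" by (simp add: update_def 2(1) R2s del: mult_Suc)
    then show ?thesis using inv1 I1k R2f R2s True by (simp add: frame_def)
  next
    case False
    obtain R3 where 3: "sem (assign (tmp d) (breg d) (Var (screg d))) (I1, R2) = (I1, R3)"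
      "agree (tmp d) B (R2(breg d := val ?L)) R3"
      using sem_assign[of "tmp d" "Var (screg d)" "breg d" B I1 R2] B_tmp unfolding eval.simps R2s(1)
      by (auto simp: tmp_def screg_def breg_def)
    have sem: "sem (update d) (I1, R1)
        = (I1(7 := I1 0 + I1 3, 0 := I1 3, 3 := I1 0), R3)"
      using False by (simp add: update_def 2(1) 3(1) R2s fun_eq_iff del: mult_Suc)
    have R3b: "R3 (breg d) = val ?L" using 3(2) by (simp add: agree_def tmp_def breg_def)
    have R3f: "R3 r = R r" if "d \<le> r \<and> r < sbase d \<or> B \<le> r" for r
    proof -
      have "r < tmp d \<or> B \<le> r" "r \<noteq> breg d"
        using that B_tmp by (auto simp: tmp_def breg_def lreg_def)
      then show ?thesis using R2f[of r] that 3(2) by (auto simp: agree_def)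
    qed
    have "has_input R3" using inv R3f by (auto simp: inv_def has_input_def base_def)
    moreover have "I1 0 = I 0" "I1 1 = I 1" "I1 2 = I 2" "I1 3 = int c" "I1 4 = I 4"
      using I1k c by auto
    moreover have "\<forall>i<n. (I1(7 := I1 0 + I1 3, 0 := I1 3, 3 := I1 0)) (c + i) = int (?L i)"
      using I1l c8 by simp
    ultimately have "inv (sem (update d) (I1, R1))"
      unfolding sem inv_def prod.case using inv c R3b
      by (intro conjI disjI2[of "_ = -1"] exI[of _ ?L]) (auto simp: inv_def)
    then show ?thesis
      unfolding sem using R3b False R3f I1k by (auto simp: frame_def)
  qed
qed

section \<open>The exhaustive search\<close>

lemma runs_body:
  assumes \<theta>: "\<theta> \<in> set (configs d)" and inv: "inv s"
    and y: "\<And>j k. j < d * d - 1 \<Longrightarrow> k < d \<Longrightarrow> snd s (Suc j * d + k) = V (ix j) k"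
  shows "runs (body d \<theta>) (bcost d \<theta> * n)
    (\<lambda>s'. inv s' \<and> frame 0 s s' \<and> val (labelling d V \<theta> ix) \<le> snd s' (breg d)) s"
proof -
  obtain I R where s: "s = (I, R)" by (cases s)
  let ?Q = "\<lambda>s'. inv s' \<and> frame 0 s s' \<and> val (labelling d V \<theta> ix) \<le> snd s' (breg d)"
  have "runs (While 6 4 (point d \<theta>)) (n * (cst (point d \<theta>) + 2) + 1) (lab_state \<theta> ix s n) s1"
    if "lab_state \<theta> ix s 0 s1" for s1
  proof (rule runs_While[where J = "lab_state \<theta> ix s"])
    fix j s2 assume "j \<le> n" "lab_state \<theta> ix s j s2"
    moreover have "4 < nat (I 3)" using inv kint_arr by (auto simp: s inv_def)
    ultimately have "fst s2 6 = int j" "fst s2 4 = int n"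
      using inv by (auto simp: s lab_state_def inv_def)
    then show "fst s2 6 < fst s2 4 \<longleftrightarrow> j < n" by simp
  next
    fix j s2 assume j: "j < n" "lab_state \<theta> ix s j s2"
    have "lab_state \<theta> ix s (Suc j) (sem (point d \<theta>) s2)"
      using sem_point[OF \<theta>, of I R ix j "fst s2" "snd s2"] inv y j by (simp add: s)
    then show "runs (point d \<theta>) (cst (point d \<theta>)) (lab_state \<theta> ix s (Suc j)) s2"
      by (intro runs_sem loopfree_point)
  qed (rule that)
  moreover have "runs (update d) (cst (update d)) ?Q s1" if "lab_state \<theta> ix s n s1" for s1
    using sem_update[of I R \<theta> ix "fst s1" "snd s1"] inv that
    by (intro runs_sem loopfree_update) (simp add: s)
  ultimately have "runs (While 6 4 (point d \<theta>) ;; update d)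
      (n * (cst (point d \<theta>) + 2) + 1 + cst (update d)) ?Q s1" if "lab_state \<theta> ix s 0 s1" for s1
    using that by (intro runs_Seq) (blast intro: runs_mono[OF _ order_refl])
  then have "runs (body d \<theta>) (cst (prelude d) + (n * (cst (point d \<theta>) + 2) + 1 + cst (update d))) ?Q s"
    unfolding body_def using sem_prelude inv
    by (intro runs_Seq[OF runs_sem[OF loopfree_prelude]]) (simp only: s)
  moreover have "cst (prelude d) + (n * (cst (point d \<theta>) + 2) + 1 + cst (update d)) \<le> bcost d \<theta> * n"
  proof -
    have "cst (prelude d) + cst (update d) + 1 \<le> (cst (prelude d) + cst (update d) + 1) * n"
      by (rule le_mult_n)
    then show ?thesis by (simp add: bcost_def algebra_simps)
  qed
  ultimately show ?thesis by (rule runs_mono) auto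
qed


text \<open>The enclosing loops have fixed the walls from \<open>j\<close> on, as recorded by
  \<open>ix\<close>; \<open>ix'\<close> ranges over all completions by choices for the first
  \<open>j\<close> walls.\<close>

lemma runs_nest:
  assumes \<theta>: "\<theta> \<in> set (configs d)" and "j \<le> d * d - 1" "inv s"
    and "\<And>m k. j \<le> m \<Longrightarrow> m < d * d - 1 \<Longrightarrow> k < d \<Longrightarrow> snd s (Suc m * d + k) = V (ix m) k"
  shows "runs (nest d \<theta> j) (ncost d \<theta> j * n ^ Suc j)
    (\<lambda>s'. inv s' \<and> frame j s s' \<and> (\<forall>ix'. (\<forall>m<j. ix' m < n) \<longrightarrow> (\<forall>m\<ge>j. ix' m = ix m) \<longrightarrow>
       val (labelling d V \<theta> ix') \<le> snd s' (breg d))) s"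
  using assms(2-)
proof (induction j arbitrary: s ix)
  case 0
  have "runs (body d \<theta>) (bcost d \<theta> * n)
    (\<lambda>s'. inv s' \<and> frame 0 s s' \<and> val (labelling d V \<theta> ix) \<le> snd s' (breg d)) s"
    using 0 by (intro runs_body[OF \<theta>]) auto
  then have "runs (body d \<theta>) (bcost d \<theta> * n ^ Suc 0)
    (\<lambda>s'. inv s' \<and> frame 0 s s' \<and> (\<forall>ix'. (\<forall>m<0. ix' m < n) \<longrightarrow> (\<forall>m\<ge>0. ix' m = ix m) \<longrightarrow>
       val (labelling d V \<theta> ix') \<le> snd s' (breg d))) s"
  proof (rule runs_mono)
    fix s' assume s': "inv s' \<and> frame 0 s s' \<and> val (labelling d V \<theta> ix) \<le> snd s' (breg d)"
    moreover have "ix' = ix" if "\<forall>m\<ge>0. ix' m = ix m" for ix' using that by auto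
    ultimately show "inv s' \<and> frame 0 s s' \<and> (\<forall>ix'. (\<forall>m<0. ix' m < n) \<longrightarrow>
      (\<forall>m\<ge>0. ix' m = ix m) \<longrightarrow> val (labelling d V \<theta> ix') \<le> snd s' (breg d))" by blast
  qed simp
  then show ?case unfolding nest.simps ncost.simps .
next
  case (Suc j)
  let ?c = "8 + j"
  let ?low = "\<lambda>ix' s'. val (labelling d V \<theta> ix') \<le> snd s' (breg d)"
  define J where "J i s' \<longleftrightarrow> inv s' \<and> fst s' ?c = int i \<and> frame (Suc j) s s' \<and>
    (\<forall>ix'. ix' j < i \<longrightarrow> (\<forall>m<j. ix' m < n) \<longrightarrow> (\<forall>m\<ge>Suc j. ix' m = ix m) \<longrightarrow> ?low ix' s')" for i s'
  let ?Tj = "ncost d \<theta> j * n ^ Suc j"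
  let ?T = "cst (load d (Suc j) ?c) + (?Tj + 1)"
  have jd: "Suc j < d * d" "?c < kint d" using Suc.prems(1) d by (auto simp: kint_def)
  have blk: "Suc (Suc m) * d \<le> sbase d" if "m < d * d - 1" for m
    unfolding sbase_def using that by (intro mult_right_mono) auto
  have blkj: "Suc j * d + d \<le> sbase d" using blk[of j] Suc.prems(1) by simp
  have inv_upd: "inv (I(?c := x), R)" if "inv (I, R)" for I R x
    using that
  proof (rule inv_cong)
    fix i assume "i < n"
    have "kint d \<le> nat (I 0)" using that kint_arr by (auto simp: inv_def)
    then show "(I(?c := x)) (nat (I 0) + i) = I (nat (I 0) + i)" using jd by simp
  qed auto
  have init: "J 0 (sem (Do (IConst ?c 0)) s)"
    using Suc.prems(2) inv_upd[of "fst s" "snd s" 0] by (cases s) (auto simp: J_def frame_def)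
  have iter: "runs (load d (Suc j) ?c ;; nest d \<theta> j ;; Do (IAdd ?c ?c 1)) ?T (J (Suc i)) s1"
    if i: "i < n" and J1: "J i s1" for i s1
  proof -
    obtain I1 R1 where s1: "s1 = (I1, R1)" by (cases s1)
    have inv1: "inv (I1, R1)" and c1: "I1 ?c = int i" and f1: "frame (Suc j) s (I1, R1)"
      using J1 by (auto simp: J_def s1)
    have "\<exists>x. sem (load d (Suc j) ?c) (I1, R1) = (I1(5 := x),
       \<lambda>q. if Suc j * d \<le> q \<and> q < Suc j * d + d then V i (q - Suc j * d) else R1 q)"
    proof (rule sem_load)
      show "Suc (Suc j) * d \<le> B" using blkj B_tmp by (simp add: tmp_def lreg_def)
    qed (use inv1 c1 i in \<open>auto simp: inv_def\<close>)
    then obtain x where x: "sem (load d (Suc j) ?c) (I1, R1) = (I1(5 := x),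
       \<lambda>q. if Suc j * d \<le> q \<and> q < Suc j * d + d then V i (q - Suc j * d) else R1 q)" by blast
    define I2 where "I2 = I1(5 := x)"
    define R2 where "R2 = (\<lambda>q. if Suc j * d \<le> q \<and> q < Suc j * d + d then V i (q - Suc j * d) else R1 q)"
    have s2: "sem (load d (Suc j) ?c) s1 = (I2, R2)" unfolding s1 x I2_def R2_def ..
    have breg2: "R2 (breg d) = R1 (breg d)" using blkj by (simp add: R2_def breg_def lreg_def)
    have inv2: "inv (I2, R2)"
      using inv1
    proof (rule inv_cong)
      fix i assume "i < n"
      have "kint d \<le> nat (I1 0)" using inv1 kint_arr by (auto simp: inv_def)
      then show "I2 (nat (I1 0) + i) = I1 (nat (I1 0) + i)" using kint_arr by (simp add: I2_def)
    next
      show "R2 r = R1 r" if "B \<le> r" for r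
        using that blkj B_tmp by (simp add: R2_def tmp_def lreg_def)
    qed (use breg2 in \<open>auto simp: I2_def\<close>)
    \<comment> \<open>The point just loaded fixes wall \<open>j\<close>, so the induction hypothesis
      is used for \<open>ix(j := i)\<close>.\<close>
    have "runs (nest d \<theta> j) ?Tj (\<lambda>s'. inv s' \<and> frame j (I2, R2) s' \<and>
        (\<forall>ix'. (\<forall>m<j. ix' m < n) \<longrightarrow> (\<forall>m\<ge>j. ix' m = (ix(j := i)) m) \<longrightarrow> ?low ix' s')) (I2, R2)"
    proof (rule Suc.IH)
      fix m k assume m: "j \<le> m" "m < d * d - 1" "k < d"
      show "snd (I2, R2) (Suc m * d + k) = V ((ix(j := i)) m) k"
      proof (cases "m = j")
        case True
        then show ?thesis using m by (simp add: R2_def)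
      next
        case False
        then have "Suc (Suc j) * d \<le> Suc m * d" using m by (intro mult_right_mono) auto
        moreover have "Suc m * d + k < sbase d" using blk[OF m(2)] m(3) by simp
        ultimately have "R1 (Suc m * d + k) = snd s (Suc m * d + k)" "\<not> Suc m * d + k < Suc j * d + d"
          using f1 by (auto simp: frame_def)
        then show ?thesis using Suc.prems(3)[of m k] m False by (simp add: R2_def)
      qed
    qed (use Suc.prems inv2 in auto)
    then have "runs (nest d \<theta> j ;; Do (IAdd ?c ?c 1)) (?Tj + 1) (J (Suc i)) (I2, R2)"
    proof (intro runs_Seq, elim runs_mono)
      fix s3 assume *: "inv s3 \<and> frame j (I2, R2) s3 \<and>
        (\<forall>ix'. (\<forall>m<j. ix' m < n) \<longrightarrow> (\<forall>m\<ge>j. ix' m = (ix(j := i)) m) \<longrightarrow> ?low ix' s3)"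
      obtain I3 R3 where s3: "s3 = (I3, R3)" by (cases s3)
      have f3: "frame j (I2, R2) (I3, R3)" and inv3: "inv (I3, R3)" using * by (auto simp: s3)
      have c3: "I3 ?c = int i" "I3 1 = 1"
        using f3 inv3 jd c1 by (auto simp: frame_def I2_def inv_def)
      have sem3: "iex (IAdd ?c ?c 1) s3 = (I3(?c := int (Suc i)), R3)"
        using c3 by (simp add: s3 add.commute)
      have mono: "R1 (breg d) \<le> R3 (breg d)" using f3 breg2 by (simp add: frame_def)
      have "frame (Suc j) s (I3(?c := int (Suc i)), R3)"
        unfolding frame_def
      proof (intro conjI allI impI)
        fix r assume "8 + Suc j \<le> r \<and> r < kint d"
        then show "fst (I3(?c := int (Suc i)), R3) r = fst s r"
          using f1 f3 by (simp add: frame_def I2_def)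
      next
        fix r assume "Suc (Suc j) * d \<le> r \<and> r < sbase d"
        then show "snd (I3(?c := int (Suc i)), R3) r = snd s r"
          using f1 f3 by (simp add: frame_def R2_def)
      next
        show "snd s (breg d) \<le> snd (I3(?c := int (Suc i)), R3) (breg d)"
          using mono f1 by (simp add: frame_def)
      qed
      moreover have "?low ix' (I3(?c := int (Suc i)), R3)"
        if ix': "ix' j < Suc i" "\<forall>m<j. ix' m < n" "\<forall>m\<ge>Suc j. ix' m = ix m" for ix'
      proof (cases "ix' j = i")
        case True
        then have "ix' m = (ix(j := i)) m" if "j \<le> m" for m
          using ix'(3) that by (cases "m = j") auto
        then show ?thesis using * ix'(2) by (simp add: s3)
      next
        case False
        then have "?low ix' s1" using J1 ix' by (simp add: J_def)
        then show ?thesis using mono by (simp add: s1)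
      qed
      ultimately have "J (Suc i) (iex (IAdd ?c ?c 1) s3)"
        unfolding sem3 J_def using inv_upd[OF inv3] by simp
      then show "runs (Do (IAdd ?c ?c 1)) 1 (J (Suc i)) s3" by (intro runs_Do) auto
    qed simp
    then show ?thesis
      by (intro runs_Seq[OF runs_sem[OF loopfree_load]]) (simp only: s2)
  qed
  have loop: "runs (While ?c 4 (load d (Suc j) ?c ;; nest d \<theta> j ;; Do (IAdd ?c ?c 1)))
     (n * (?T + 2) + 1) (J n) (sem (Do (IConst ?c 0)) s)"
  proof (rule runs_While[where J = J])
    fix i s' assume "J i s'"
    then have "fst s' ?c = int i" "fst s' 4 = int n" by (auto simp: J_def inv_def split: prod.splits)
    then show "fst s' ?c < fst s' 4 \<longleftrightarrow> i < n" by simp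
  qed (use init iter in auto)
  have "runs (nest d \<theta> (Suc j)) (1 + (n * (?T + 2) + 1)) (J n) s"
    unfolding nest.simps using loop by (intro runs_Seq runs_Do) auto
  moreover have "1 + (n * (?T + 2) + 1) \<le> ncost d \<theta> (Suc j) * n ^ Suc (Suc j)"
  proof -
    define N where "N = n * n ^ Suc j"
    define cl where "cl = cst (load d (Suc j) ?c)"
    \<comment> \<open>All overhead of this level is absorbed into \<open>N\<close>, the full power
      of \<open>n\<close>.\<close>
    have "n \<le> N" "1 \<le> N" using n by (auto simp: N_def)
    have "1 + (n * (?T + 2) + 1) = 2 + n * (cl + 3) + ncost d \<theta> j * N"
      by (simp add: N_def cl_def algebra_simps)
    also have "\<dots> \<le> 2 * N + N * (cl + 3) + ncost d \<theta> j * N"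
      using \<open>n \<le> N\<close> \<open>1 \<le> N\<close> by (intro add_mono mult_right_mono) auto
    also have "\<dots> = ncost d \<theta> (Suc j) * n ^ Suc (Suc j)"
      by (simp add: N_def cl_def algebra_simps)
    finally show ?thesis .
  qed
  ultimately show ?case
  proof (rule runs_mono)
    fix s' assume "J n s'"
    then show "inv s' \<and> frame (Suc j) s s' \<and> (\<forall>ix'. (\<forall>m<Suc j. ix' m < n) \<longrightarrow>
       (\<forall>m\<ge>Suc j. ix' m = ix m) \<longrightarrow> ?low ix' s')"
      by (auto simp: J_def)
  qed
qed

lemma runs_search:
  assumes "inv s"
  shows "runs (seqs (map (\<lambda>\<theta>. nest d \<theta> (d * d - 1)) (configs d)))
     (length (configs d) * ((\<Sum>\<theta>\<leftarrow>configs d. ncost d \<theta> (d * d - 1)) * n ^ (d * d)))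
     (\<lambda>s'. inv s' \<and> (\<forall>\<theta>\<in>set (configs d). \<forall>ix. (\<forall>m. ix m < n) \<longrightarrow>
        val (labelling d V \<theta> ix) \<le> snd s' (breg d))) s"
proof -
  let ?m = "d * d - 1"
  let ?low = "\<lambda>\<theta> s'. \<forall>ix::nat \<Rightarrow> nat. (\<forall>m. ix m < n) \<longrightarrow> val (labelling d V \<theta> ix) \<le> snd s' (breg d)"
  define J where "J D s' \<longleftrightarrow> inv s' \<and> (\<forall>\<theta>\<in>D. ?low \<theta> s')" for D s'
  have m: "Suc ?m = d * d" using d by simp
  have "runs (seqs (map (\<lambda>\<theta>. nest d \<theta> ?m) (configs d)))
     (length (configs d) * ((\<Sum>\<theta>\<leftarrow>configs d. ncost d \<theta> ?m) * n ^ (d * d)))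
     (J (set (configs d) \<union> {})) s"
  proof (rule runs_seqs_map)
    fix D \<theta> s1 assume \<theta>: "\<theta> \<in> set (configs d)" and J1: "J D s1"
    have step: "runs (nest d \<theta> ?m) (ncost d \<theta> ?m * n ^ Suc ?m) (\<lambda>s'. inv s' \<and> frame ?m s1 s' \<and>
      (\<forall>ix'. (\<forall>m<?m. ix' m < n) \<longrightarrow> (\<forall>m\<ge>?m. ix' m = ix m) \<longrightarrow>
         val (labelling d V \<theta> ix') \<le> snd s' (breg d))) s1" for ix
      using J1 by (intro runs_nest[OF \<theta>]) (auto simp: J_def)
    \<comment> \<open>Only the first \<open>d * d - 1\<close> entries of \<open>ix\<close> are read;
      the others are set to \<open>0\<close> to match the fixed tail in \<open>step\<close>.\<close>
    have trunc: "labelling d V \<theta> ix = labelling d V \<theta> (\<lambda>m. if m < ?m then ix m else 0)" for ix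
    proof -
      obtain cs l sg where \<theta>eq: "\<theta> = (cs, l, sg)" by (cases \<theta>) auto
      have "length cs = ?m" using \<theta> by (auto simp: \<theta>eq configs_def set_n_lists)
      then have "walls d V cs ix = walls d V cs (\<lambda>m. if m < ?m then ix m else 0)"
        by (simp add: walls_def)
      then show ?thesis by (auto simp: \<theta>eq fun_eq_iff)
    qed
    show "runs (nest d \<theta> ?m) ((\<Sum>\<theta>\<leftarrow>configs d. ncost d \<theta> ?m) * n ^ (d * d)) (J (insert \<theta> D)) s1"
    proof (rule runs_mono[OF step[of "\<lambda>_. 0"]])
      have "ncost d \<theta> ?m \<le> (\<Sum>\<theta>\<leftarrow>configs d. ncost d \<theta> ?m)"
        using \<theta> by (intro member_le_sum_list) auto
      then show "ncost d \<theta> ?m * n ^ Suc ?m \<le> (\<Sum>\<theta>\<leftarrow>configs d. ncost d \<theta> ?m) * n ^ (d * d)"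
        unfolding m by (rule mult_right_mono) simp
    next
      fix s' assume s': "inv s' \<and> frame ?m s1 s' \<and> (\<forall>ix'. (\<forall>m<?m. ix' m < n) \<longrightarrow>
        (\<forall>m\<ge>?m. ix' m = 0) \<longrightarrow> val (labelling d V \<theta> ix') \<le> snd s' (breg d))"
      have "?low \<theta> s'"
      proof (intro allI impI)
        fix ix :: "nat \<Rightarrow> nat" assume "\<forall>m. ix m < n"
        then show "val (labelling d V \<theta> ix) \<le> snd s' (breg d)"
          unfolding trunc[of ix] using s' by auto
      qed
      moreover have "snd s1 (breg d) \<le> snd s' (breg d)" using s' by (simp add: frame_def)
      moreover have "?low \<theta>' s1" if "\<theta>' \<in> D" for \<theta>' using J1 that by (simp add: J_def)
      ultimately have "?low \<theta>' s'" if "\<theta>' \<in> insert \<theta> D" for \<theta>'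
        using that by (metis insertE order_trans)
      then show "J (insert \<theta> D) s'" using s' by (simp only: J_def) blast
    qed
  qed (use assms in \<open>simp add: J_def\<close>)
  then show ?thesis by (rule runs_mono) (auto simp: J_def)
qed

section \<open>Moving the input, and writing the output\<close>

definition start :: mem where
  "start = (\<lambda>r. if r = 0 then int n else if r = 1 then int d else 0,
     \<lambda>r. if r < n * d then V (r div d) (r mod d) else 0)"

lemma sem_copy:
  assumes "I 1 = 1" "m \<le> B"
  shows "sem (seqs (map (\<lambda>r. Do (RStore 5 r) ;; Do (IAdd 5 5 1)) [0..<m])) (I(5 := int base), R)
     = (I(5 := int (base + m)), \<lambda>q. if base \<le> q \<and> q < base + m then R (q - base) else R q)"
  using assms(2)
proof (induction m)
  case 0
  show ?case by auto
next
  case (Suc m)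
  have "m < base" using Suc.prems by (simp add: base_def)
  moreover have "nat (int base + int m) = base + m" by simp
  ultimately show ?case
    using Suc assms(1) by (auto simp: fun_eq_iff less_Suc_eq)
qed

lemma runs_prepare:
  "runs (prepare d B) ((cst (prep_copy d B) + d * 6 + 2) * n) (\<lambda>s. inv s \<and> snd s (breg d) = -1) start"
proof -
  define R0 where "R0 = snd start"
  define I where "I = fst (sem (prep_copy d B) start)"
  \<comment> \<open>Truncated subtraction: if the input fits into the first \<open>B\<close>
    registers, the copying loop does nothing.\<close>
  define N where "N = n * d - B"
  have sem1: "fst (sem (prep_copy d B) start) 0 = int (arr + n)
      \<and> fst (sem (prep_copy d B) start) 1 = 1
      \<and> fst (sem (prep_copy d B) start) 2 = int base
      \<and> fst (sem (prep_copy d B) start) 3 = int arr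
      \<and> fst (sem (prep_copy d B) start) 4 = int n
      \<and> fst (sem (prep_copy d B) start) 5 = int (base + B)
      \<and> fst (sem (prep_copy d B) start) 6 = int B
      \<and> fst (sem (prep_copy d B) start) 7 = int (n * d)
      \<and> snd (sem (prep_copy d B) start) = (\<lambda>q. if base \<le> q \<and> q < base + B then R0 (q - base) else R0 q)"
  proof -
    let ?I = "(fst start)(1 := 1, 7 := int (n * d), 2 := int base, 4 := int n, 3 := int arr, 0 := int (arr + n))"
    have eq: "sem (prep_copy d B) start = sem (Do (IConst 6 (int B)))
       (sem (seqs (map (\<lambda>r. Do (RStore 5 r) ;; Do (IAdd 5 5 1)) [0..<B])) (?I(5 := int base), R0))"
      by (simp add: prep_copy_def start_def sem_add_repeat R0_def base_def arr_def mult.commute add.commute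
          fun_upd_twist)
    have copy: "sem (seqs (map (\<lambda>r. Do (RStore 5 r) ;; Do (IAdd 5 5 1)) [0..<B])) (?I(5 := int base), R0)
       = (?I(5 := int (base + B)), \<lambda>q. if base \<le> q \<and> q < base + B then R0 (q - base) else R0 q)"
      by (rule sem_copy) simp_all
    show ?thesis unfolding eq copy by simp
  qed
  \<comment> \<open>Register \<open>0\<close> is excluded by \<open>0 < q\<close>, since each value
    copied passes through it.\<close>
  define J where "J j s \<longleftrightarrow> (case s of (I', R') \<Rightarrow> I' 6 = int (B + j) \<and> I' 5 = int (base + B + j)
      \<and> (\<forall>r. r \<notin> {5, 6} \<longrightarrow> I' r = I r)
      \<and> (\<forall>q<B + j. R' (base + q) = R0 q) \<and> (\<forall>q. 0 < q \<and> q < base \<longrightarrow> R' q = R0 q))" for j s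
  have "runs (While 6 7 copy_step) (N * (4 + 2) + 1) (J N) (sem (prep_copy d B) start)"
  proof (rule runs_While[where J = J])
    show "J 0 (sem (prep_copy d B) start)"
      using sem1 by (cases "sem (prep_copy d B) start") (auto simp: J_def I_def)
    fix j s assume "J j s"
    then have "fst s 6 = int (B + j)" "fst s 7 = int (n * d)"
      using sem1 by (auto simp: J_def I_def split: prod.splits)
    then have "fst s 6 < fst s 7 \<longleftrightarrow> B + j < n * d" by (simp only: of_nat_less_iff)
    then show "fst s 6 < fst s 7 \<longleftrightarrow> j < N" unfolding N_def by linarith
  next
    fix j s assume j: "j < N" and s: "J j s"
    obtain I' R' where s': "s = (I', R')" by (cases s)
    have lt: "B + j < n * d" "0 < B" "n * d \<le> base" using j B_tmp by (auto simp: N_def base_def)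
    have h: "I' 6 = int (B + j)" "I' 5 = int (base + B + j)" "I' 1 = 1" "R' (B + j) = R0 (B + j)"
      using s sem1 lt by (auto simp: J_def I_def s')
    have "sem copy_step s = (I'(5 := int (base + B + Suc j), 6 := int (B + Suc j)),
        R'(0 := R0 (B + j), base + B + j := R0 (B + j)))"
      using h lt unfolding s' copy_step_def by (simp add: nat_add_distrib add_ac)
    then have "J (Suc j) (sem copy_step s)"
      using s lt by (auto simp: J_def s' less_Suc_eq)
    moreover have "cst copy_step = 4" "loopfree copy_step" by (simp_all add: copy_step_def)
    ultimately show "runs copy_step 4 (J (Suc j)) s"
      using runs_sem[of copy_step "J (Suc j)" s] by simp
  qed
  moreover have "runs (Do (RConst (breg d) (-1))) 1 (\<lambda>s. inv s \<and> snd s (breg d) = -1) s"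
    if s: "J N s" for s
  proof -
    obtain I' R' where s': "s = (I', R')" by (cases s)
    have "has_input (R'(breg d := -1))"
      unfolding has_input_def
    proof (intro allI impI)
      fix i k assume ik: "i < n" "k < d"
      have "Suc i * d \<le> n * d" using ik by (intro mult_right_mono) auto
      then have lt: "i * d + k < n * d" using ik by simp
      then have "i * d + k < B + N" by (simp add: N_def)
      then have "R' (base + (i * d + k)) = R0 (i * d + k)" using s by (simp add: J_def s')
      also have "\<dots> = V i k" using lt ik by (simp add: R0_def start_def)
      finally show "(R'(breg d := -1)) (base + i * d + k) = V i k"
        using B_tmp by (simp add: base_def tmp_def breg_def add.assoc)
    qed
    then have "inv (I', R'(breg d := -1))"
      using s sem1 by (simp add: inv_def J_def s' I_def)
    then show ?thesis by (intro runs_Do) (auto simp: s')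
  qed
  ultimately have "runs (While 6 7 copy_step ;; Do (RConst (breg d) (-1))) (N * (4 + 2) + 1 + 1)
      (\<lambda>s. inv s \<and> snd s (breg d) = -1) (sem (prep_copy d B) start)"
    by (intro runs_Seq) (rule runs_mono[OF _ order_refl])
  then have "runs (prepare d B) (cst (prep_copy d B) + (N * (4 + 2) + 1 + 1))
      (\<lambda>s. inv s \<and> snd s (breg d) = -1) start"
    unfolding prepare_def by (intro runs_Seq[OF runs_sem[OF loopfree_prep_copy]])
  moreover have "cst (prep_copy d B) + (N * (4 + 2) + 1 + 1) \<le> (cst (prep_copy d B) + d * 6 + 2) * n"
  proof -
    have "N * 6 \<le> n * d * 6" by (simp add: N_def)
    moreover have "cst (prep_copy d B) + 2 \<le> (cst (prep_copy d B) + 2) * n" by (rule le_mult_n)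
    ultimately show ?thesis by (simp add: algebra_simps)
  qed
  ultimately show ?thesis by (rule runs_mono)
qed

text \<open>The array starts at or above \<open>kint d\<close>, so overwriting the registers below
  leaves the labels still to be read intact.\<close>

lemma sem_emit_fixed:
  assumes b: "I 0 = int b" "kint d \<le> b"
  shows "\<exists>I'. sem (emit_fixed d) (I, R) = (I', R) \<and> (\<forall>r<kint d. I' r = I (b + r)) \<and> (\<forall>r\<ge>kint d. I' r = I r)"
proof -
  let ?c = "\<lambda>r. Do (IConst r (int r)) ;; Do (IAdd r r 0) ;; Do (ILoad r r)"
  have "sem (seqs (map ?c [1..<Suc m])) (I, R) = (\<lambda>r. if 1 \<le> r \<and> r \<le> m then I (b + r) else I r, R)"
    if "m < kint d" for m
    using that
  proof (induction m)
    case 0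
    show ?case by (auto simp: fun_eq_iff)
  next
    case (Suc m)
    have "[1..<Suc (Suc m)] = [1..<Suc m] @ [Suc m]" by simp
    moreover have "nat (int (Suc m) + int b) = b + Suc m" by simp
    ultimately show ?case
      using Suc b by (auto simp: fun_eq_iff simp del: upt_Suc)
  qed
  from this[of "kint d - 1"] have "sem (seqs (map ?c [1..<kint d])) (I, R)
      = (\<lambda>r. if 1 \<le> r \<and> r \<le> kint d - 1 then I (b + r) else I r, R)" using kint_arr by simp
  then have "sem (emit_fixed d) (I, R) = (\<lambda>r. if r < kint d then I (b + r) else I r, R)"
    using b kint_arr by (auto simp: emit_fixed_def fun_eq_iff)
  then show ?thesis by simp
qed

lemma runs_emit:
  assumes inv: "inv s" and ne: "snd s (breg d) \<noteq> -1"
  shows "runs (emit d) ((cst (emit_fixed d) + 8) * n)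
    (\<lambda>s'. \<exists>f. val f = snd s (breg d) \<and> (\<forall>i<n. fst s' i = int (f i))) s"
proof -
  obtain I R where s: "s = (I, R)" by (cases s)
  define b where "b = nat (I 0)"
  have b: "I 0 = int b" "arr \<le> b" using inv by (auto simp: b_def s inv_def)
  obtain f where f: "\<forall>i<n. I (b + i) = int (f i)" "R (breg d) = val f"
    using inv ne by (auto simp: inv_def s b_def)
  define N where "N = n - kint d"
  define J where "J j s' \<longleftrightarrow> fst s' 6 = int (kint d + j)
     \<and> (\<forall>r<kint d. r \<notin> {5, 6, 7} \<longrightarrow> fst s' r = I r) \<and> (\<forall>r\<ge>arr. fst s' r = I r)
     \<and> (\<forall>i<j. fst s' (kint d + i) = int (f (kint d + i)))" for j and s' :: mem
  have "runs (While 6 4 emit_step) (N * (4 + 2) + 1) (J N) (iex (IConst 6 (int (kint d))) s)"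
  proof (rule runs_While[where J = J])
    show "J 0 (iex (IConst 6 (int (kint d))) s)" using kint_arr by (auto simp: J_def s)
    fix j s' assume "J j s'"
    then have "fst s' 6 = int (kint d + j)" "fst s' 4 = int n"
      using inv kint_arr by (auto simp: J_def inv_def s)
    then show "fst s' 6 < fst s' 4 \<longleftrightarrow> j < N" by (simp add: N_def) linarith
  next
    fix j s' assume j: "j < N" and J1: "J j s'"
    obtain I' R' where s': "s' = (I', R')" by (cases s')
    have lt: "kint d + j < n" "kint d + j < arr" using j by (auto simp: N_def arr_def)
    have h: "I' 0 = int b" "I' 1 = 1" "I' 6 = int (kint d + j)" "I' (b + (kint d + j)) = int (f (kint d + j))"
      using J1 inv b f lt kint_arr by (auto simp: J_def s' s inv_def)
    have "sem emit_step s' = (I'(5 := int (b + (kint d + j)), 7 := int (f (kint d + j)),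
        kint d + j := int (f (kint d + j)), 6 := int (kint d + Suc j)), R')"
      using h kint_arr unfolding s' emit_step_def by (auto simp: nat_add_distrib)
    then have "J (Suc j) (sem emit_step s')"
      using J1 lt kint_arr by (auto simp: J_def s' less_Suc_eq)
    moreover have "cst emit_step = 4" "loopfree emit_step" by (simp_all add: emit_step_def)
    ultimately show "runs emit_step 4 (J (Suc j)) s'"
      using runs_sem[of emit_step "J (Suc j)" s'] by simp
  qed
  moreover have "runs (emit_fixed d) (cst (emit_fixed d))
      (\<lambda>s'. \<exists>f. val f = snd s (breg d) \<and> (\<forall>i<n. fst s' i = int (f i))) s'" if J1: "J N s'" for s'
  proof (rule runs_sem[OF loopfree_emit_fixed])
    obtain I1 R1 where s1: "s' = (I1, R1)" by (cases s')
    have "I1 0 = int b" "kint d \<le> b" using J1 b kint_arr by (auto simp: J_def s1)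
    then obtain I2 where I2: "sem (emit_fixed d) (I1, R1) = (I2, R1)"
      "\<forall>r<kint d. I2 r = I1 (b + r)" "\<forall>r\<ge>kint d. I2 r = I1 r"
      using sem_emit_fixed by blast
    have "I2 i = int (f i)" if i: "i < n" for i
    proof (cases "i < kint d")
      case True
      then show ?thesis using I2 J1 f i b by (simp add: J_def s1)
    next
      case False
      then have "i - kint d < N" using i by (simp add: N_def)
      then have "I1 (kint d + (i - kint d)) = int (f (kint d + (i - kint d)))"
        using J1 unfolding J_def s1 fst_conv by blast
      then show ?thesis using I2 False by simp
    qed
    then show "\<exists>f. val f = snd s (breg d) \<and> (\<forall>i<n. fst (sem (emit_fixed d) s') i = int (f i))"
      using f(2) I2(1) by (intro exI[of _ f]) (simp add: s s1)
  qed
  ultimately have "runs (While 6 4 emit_step ;; emit_fixed d) (N * (4 + 2) + 1 + cst (emit_fixed d))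
      (\<lambda>s'. \<exists>f. val f = snd s (breg d) \<and> (\<forall>i<n. fst s' i = int (f i))) (iex (IConst 6 (int (kint d))) s)"
    by (intro runs_Seq) (rule runs_mono[OF _ order_refl])
  then have "runs (emit d) (1 + (N * (4 + 2) + 1 + cst (emit_fixed d)))
      (\<lambda>s'. \<exists>f. val f = snd s (breg d) \<and> (\<forall>i<n. fst s' i = int (f i))) s"
    unfolding emit_def by (intro runs_Seq[OF runs_Do]) auto
  moreover have "1 + (N * (4 + 2) + 1 + cst (emit_fixed d)) \<le> (cst (emit_fixed d) + 8) * n"
  proof -
    have "N * 6 \<le> n * 6" by (simp add: N_def)
    moreover have "cst (emit_fixed d) + 2 \<le> (cst (emit_fixed d) + 2) * n" by (rule le_mult_n)
    ultimately show ?thesis by (simp add: algebra_simps)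
  qed
  ultimately show ?thesis by (rule runs_mono)
qed

lemma runs_main:
  "runs (main d B) ((cst (prep_copy d B) + d * 6 + 2
       + length (configs d) * (\<Sum>\<theta>\<leftarrow>configs d. ncost d \<theta> (d * d - 1))
       + (cst (emit_fixed d) + 8)) * n ^ (d * d))
     (\<lambda>s. cc_optimal n (gram d V) (fst s)) start"
proof -
  obtain \<theta> ix where \<theta>: "\<theta> \<in> set (configs d)" "\<forall>j. ix j < n"
    and opt: "\<forall>g::nat \<Rightarrow> nat. val g \<le> val (labelling d V \<theta> ix)"
    using some_labelling_optimal[OF d n, of V] unfolding val_def by blast
  let ?S = "length (configs d) * ((\<Sum>\<theta>\<leftarrow>configs d. ncost d \<theta> (d * d - 1)) * n ^ (d * d))"
  let ?Q = "\<lambda>s. cc_optimal n (gram d V) (fst s)"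
  have fin: "?Q s'" if s': "val f = x" "\<forall>i<n. fst s' i = int (f i)" and x: "val (labelling d V \<theta> ix) \<le> x"
    for s' :: mem and f x
    unfolding cc_optimal_def
  proof (intro allI impI)
    fix g :: "nat \<Rightarrow> nat"
    have "val g \<le> val f" using opt s'(1) x by (meson order_trans order_refl)
    moreover have "same_sum n (gram d V) (fst s') = val f"
      unfolding val_def same_sum_def using s'(2) by (intro sum.cong refl) auto
    ultimately show "cc_obj n (gram d V) g \<le> cc_obj n (gram d V) (fst s')"
      by (simp add: cc_obj_le_iff val_def)
  qed
  \<comment> \<open>After the search the best score dominates this value, so it is no longer
    \<open>-1\<close> and a labelling has been stored.\<close>
  have nonneg: "0 \<le> val (labelling d V \<theta> ix)"
    by (subst val_eq) (auto simp: labelling_le intro: sum_nonneg)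
  have emit: "runs (emit d) ((cst (emit_fixed d) + 8) * n) ?Q s"
    if s: "inv s" "val (labelling d V \<theta> ix) \<le> snd s (breg d)" for s
  proof (rule runs_mono[OF runs_emit])
    show "snd s (breg d) \<noteq> -1" using s(2) nonneg by linarith
  qed (use s fin in auto)
  have search: "runs (seqs (map (\<lambda>\<theta>. nest d \<theta> (d * d - 1)) (configs d)) ;; emit d)
      (?S + (cst (emit_fixed d) + 8) * n) ?Q s" if "inv s" for s
    by (rule runs_Seq, rule runs_mono[OF runs_search[OF that] order_refl]) (use emit \<theta> in blast)
  have "runs (main d B) ((cst (prep_copy d B) + d * 6 + 2) * n + (?S + (cst (emit_fixed d) + 8) * n)) ?Q start"
    unfolding main_def
    by (rule runs_Seq, rule runs_mono[OF runs_prepare order_refl]) (use search in blast)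
  moreover have "(cst (prep_copy d B) + d * 6 + 2) * n + (?S + (cst (emit_fixed d) + 8) * n)
     \<le> (cst (prep_copy d B) + d * 6 + 2) * n ^ (d * d) + (?S + (cst (emit_fixed d) + 8) * n ^ (d * d))"
  proof -
    have "n \<le> n ^ (d * d)" using n d by (intro self_le_power) auto
    then show ?thesis by (intro add_mono mult_left_mono) auto
  qed
  ultimately show ?thesis by (elim runs_mono) (auto simp: algebra_simps)
qed

end

theorem theorem5:
  fixes d :: nat
  assumes "d \<ge> 1"
  shows "\<exists>(P :: instr list) (C :: real). \<forall>(n :: nat) (V :: nat \<Rightarrow> nat \<Rightarrow> real). n \<ge> 1 \<longrightarrow>
           (\<exists>k. halted P (run P (init n d V) k)
                \<and> real k \<le> C * real n ^ (d ^ 2)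
                \<and> cc_optimal n (gram d V) (ireg (run P (init n d V) k)))"
proof -
  \<comment> \<open>\<open>B\<close> depends on \<open>d\<close> only, which makes the program and
    the constant uniform in \<open>n\<close> and \<open>V\<close>. The \<open>10\<close> leaves room
    for \<open>accE\<close>, whose depth is \<open>4\<close>.\<close>
  define B where "B = tmp d + (\<Sum>\<theta>\<leftarrow>configs d. depth (labE d \<theta>)) + depth (scoreE d (Suc d * d)) + 10"
  define c where "c = cst (prep_copy d B) + d * 6 + 2
       + length (configs d) * (\<Sum>\<theta>\<leftarrow>configs d. ncost d \<theta> (d * d - 1))
       + (cst (emit_fixed d) + 8)"
  let ?P = "comp (main d B) 0"
  have "\<exists>k. halted ?P (run ?P (init n d V) k) \<and> real k \<le> real c * real n ^ (d ^ 2)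
      \<and> cc_optimal n (gram d V) (ireg (run ?P (init n d V) k))" if n: "n \<ge> 1" for n V
  proof -
    interpret instance_data d B n V
    proof
      fix \<theta> assume "\<theta> \<in> set (configs d)"
      then have "depth (labE d \<theta>) \<le> (\<Sum>\<theta>\<leftarrow>configs d. depth (labE d \<theta>))"
        by (intro member_le_sum_list) auto
      then show "tmp d + depth (labE d \<theta>) \<le> B" by (simp add: B_def)
    next
      show "tmp d + depth (accE d r) \<le> B" for r by (simp add: accE_def B_def Let_def)
    qed (use assms n in \<open>auto simp: B_def\<close>)
    have "loaded ?P 0 ?P" by (simp add: loaded_def)
    then obtain t s where t: "t \<le> c * n ^ (d * d)" "run ?P (mk 0 start) t = mk (0 + clen (main d B)) s"
      "cc_optimal n (gram d V) (fst s)"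
      using runsD[OF runs_main] unfolding c_def by blast
    have "init n d V = mk 0 start" by (simp add: init_def mk_def start_def)
    moreover have "halted ?P (mk (clen (main d B)) s)" by (simp add: halted_def mk_def)
    moreover have "real t \<le> real c * real n ^ (d ^ 2)"
      using t(1) by (metis of_nat_le_iff of_nat_mult of_nat_power power2_eq_square)
    moreover have "ireg (mk (clen (main d B)) s) = fst s" by (simp add: mk_def)
    ultimately show ?thesis using t by (intro exI[of _ t]) simp
  qed
  then show ?thesis by blast
qed

end
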